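(* Let $s\in(0,1)$, $N>2s$, and let $a\in L^\infty(\mathbb{R}^N)$ with $a>0$. There exists $d>0$ such that for every nonnegative functional $f\in \dot H^s(\mathbb{R}^N)'$ with $f\not\equiv 0$ and $\|f\|_{\dot H^s(\mathbb{R}^N)'}\le d$, the equation $$(-\Delta)^s u = a(x)|u|^{2^*_s-2}u+f\ \text{ in }\mathbb{R}^N,\qquad u>0\ \text{ in }\mathbb{R}^N,\qquad u\in\dot H^s(\mathbb{R}^N),$$ admits a positive weak solution $u$ whose energy is negative, i.e. $\bar I_{a,f}(u)<0$.
   Context: Here $2^*_s:=\frac{2N}{N-2s}$. The space $\dot H^s(\mathbb{R}^N)$ is the set of (real-valued) $u\in L^{2^*_s}(\mathbb{R}^N)$ with $\|u\|_{\dot H^s(\mathbb{R}^N)}:=\Big(\iint_{\mathbb{R}^{2N}}\frac{|u(x)-u(y)|^2}{|x-y|^{N+2s}}\,dx\,dy\Big)^{1/2}<\infty$, a Hilbert space with the corresponding inner product; $\dot H^s(\mathbb{R}^N)'$ is its dual with the dual norm, and $\langle f,u\rangle$ denotes the duality bracket. A functional $f\in\dot H^s(\mathbb{R}^N)'$ is nonnegative if $\langle f,u\rangle\ge 0$ for every $u\in\dot H^s(\mathbb{R}^N)$ with $u\ge 0$. A positive weak solution of the equation is a function $u\in\dot H^s(\mathbb{R}^N)$ with $u>0$ in $\mathbb{R}^N$ such that for every $\phi\in\dot H^s(\mathbb{R}^N)$ $$\iint_{\mathbb{R}^{2N}}\frac{(u(x)-u(y))(\phi(x)-\phi(y))}{|x-y|^{N+2s}}\,dx\,dy=\int_{\mathbb{R}^N}a(x)u^{2^*_s-1}\phi\,dx+\langle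 f,\phi\rangle .$$ The energy is $\bar I_{a,f}(u)=\frac12\|u\|_{\dot H^s(\mathbb{R}^N)}^2-\frac1{2^*_s}\int_{\mathbb{R}^N}a(x)|u|^{2^*_s}\,dx-\langle f,u\rangle$. *)

theory Defs
  imports "HOL-Analysis.Analysis"
begin

text \<open>
  Elements of function spaces on \<open>\<real>\<^sup>N\<close> are represented by Lebesgue measurable functions;
  accordingly, pointwise inequalities between them are understood almost everywhere.
\<close>

definition Linfty :: "('a::euclidean_space \<Rightarrow> real) set" where
  "Linfty = {a \<in> borel_measurable lebesgue. \<exists>C. AE x in lebesgue. \<bar>a x\<bar> \<le> C}"

definition crit_exp :: "nat \<Rightarrow> real \<Rightarrow> real" where
  "crit_exp N s = 2 * real N / (real N - 2 * s)"

text \<open>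
  The value of the integrand on the diagonal is \<open>0 / 0 = 0\<close>; the diagonal is a null set.
\<close>

definition gagliardo_integrand ::
    "real \<Rightarrow> ('a::euclidean_space \<Rightarrow> real) \<Rightarrow> ('a \<Rightarrow> real) \<Rightarrow> 'a \<times> 'a \<Rightarrow> real" where
  "gagliardo_integrand s u v = (\<lambda>(x, y).
     (u x - u y) * (v x - v y) / norm (x - y) powr (real DIM('a) + 2 * s))"

definition gagliardo_form ::
    "real \<Rightarrow> ('a::euclidean_space \<Rightarrow> real) \<Rightarrow> ('a \<Rightarrow> real) \<Rightarrow> real" where
  "gagliardo_form s u v =
     integral\<^sup>L (lebesgue \<Otimes>\<^sub>M lebesgue) (gagliardo_integrand s u v)"

definition Hdot :: "real \<Rightarrow> ('a::euclidean_space \<Rightarrow> real) set" where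
  "Hdot s = {u \<in> borel_measurable lebesgue.
     integrable lebesgue (\<lambda>x. \<bar>u x\<bar> powr crit_exp DIM('a) s) \<and>
     integrable (lebesgue \<Otimes>\<^sub>M lebesgue) (gagliardo_integrand s u u)}"

definition Hdot_norm :: "real \<Rightarrow> ('a::euclidean_space \<Rightarrow> real) \<Rightarrow> real" where
  "Hdot_norm s u = sqrt (gagliardo_form s u u)"

text \<open>
  Functionals act on representatives. Boundedness and linearity force them to agree on functions
  that are equal almost everywhere, since the difference of two such functions has norm \<open>0\<close>.
  Values outside of \<open>Hdot s\<close> are irrelevant.
\<close>

definition Hdot_dual :: "real \<Rightarrow> (('a::euclidean_space \<Rightarrow> real) \<Rightarrow> real) set" where
  "Hdot_dual s = {f.
     (\<forall>u\<in>Hdot s. \<forall>v\<in>Hdot s. f (\<lambda>x. u x + v x) = f u + f v) \<and>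
     (\<forall>c. \<forall>u\<in>Hdot s. f (\<lambda>x. c * u x) = c * f u) \<and>
     (\<exists>C. \<forall>u\<in>Hdot s. \<bar>f u\<bar> \<le> C * Hdot_norm s u)}"

definition Hdot_dual_norm :: "real \<Rightarrow> (('a::euclidean_space \<Rightarrow> real) \<Rightarrow> real) \<Rightarrow> real" where
  "Hdot_dual_norm s f = (SUP u\<in>{u \<in> Hdot s. Hdot_norm s u \<le> 1}. \<bar>f u\<bar>)"

definition nonneg_functional :: "real \<Rightarrow> (('a::euclidean_space \<Rightarrow> real) \<Rightarrow> real) \<Rightarrow> bool" where
  "nonneg_functional s f \<longleftrightarrow> (\<forall>u\<in>Hdot s. (AE x in lebesgue. 0 \<le> u x) \<longrightarrow> 0 \<le> f u)"

definition positive_weak_solution ::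
    "real \<Rightarrow> ('a::euclidean_space \<Rightarrow> real) \<Rightarrow> (('a \<Rightarrow> real) \<Rightarrow> real) \<Rightarrow> ('a \<Rightarrow> real) \<Rightarrow> bool" where
  "positive_weak_solution s a f u \<longleftrightarrow>
     u \<in> Hdot s \<and> (AE x in lebesgue. 0 < u x) \<and>
     (\<forall>\<phi>\<in>Hdot s. gagliardo_form s u \<phi> =
        (LINT x|lebesgue. a x * u x powr (crit_exp DIM('a) s - 1) * \<phi> x) + f \<phi>)"

definition energy ::
    "real \<Rightarrow> ('a::euclidean_space \<Rightarrow> real) \<Rightarrow> (('a \<Rightarrow> real) \<Rightarrow> real) \<Rightarrow> ('a \<Rightarrow> real) \<Rightarrow> real" where
  "energy s a f u =
     1 / 2 * (Hdot_norm s u)\<^sup>2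
     - 1 / crit_exp DIM('a) s * (LINT x|lebesgue. a x * \<bar>u x\<bar> powr crit_exp DIM('a) s)
     - f u"

end

theory Submission
  imports Defs
begin

text \<open>
  Write \<open>N\<close> for the dimension, \<open>p = 2N/(N - 2s)\<close>, \<open>[u]\<close> for the norm of \<open>Hdot s\<close> and \<open>u\<^sub>+\<close> for the
  positive part of \<open>u\<close>. The solution is found by minimising the truncated energy
  \<open>J(u) = [u]\<^sup>2/2 - (1/p) \<integral> a u\<^sub>+\<^sup>p - f u\<close> over a small ball \<open>[u] \<le> R\<close>. The power \<open>p\<close> exceeds \<open>2\<close>, so the
  second-order part of the critical term is at most a multiple of \<open>R\<close> to the power \<open>p - 2\<close> times
  \<open>[\<cdot>]\<^sup>2\<close>, and for small \<open>R\<close> the quadratic term dominates it: \<open>J\<close> is uniformly convex on the ball.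
  Convexity takes the place of compactness: by the midpoint inequality
  (\<open>trunc_energy_midpoint_convex\<close>) every minimising sequence is a Cauchy sequence, and it
  converges because \<open>Hdot s\<close> is complete (\<open>Hdot_complete\<close>).

  The functional \<open>f\<close> is nonzero, so \<open>J\<close> is negative at a small multiple of some element; if
  the dual norm of \<open>f\<close> is at most \<open>R/4\<close>, then \<open>J \<ge> 0\<close> on the sphere \<open>[u] = R\<close>. Hence the minimiser lies
  inside the ball and solves the Euler-Lagrange equation (\<open>local_minimizer_solves\<close>). Testing it with
  the negative part shows that the minimiser may be replaced by its positive part.

  Strict positivity is a nonlocal strong maximum principle
  (\<open>nonlocal_strong_maximum_principle\<close>). Testing with \<open>\<psi> \<cdot> (1 - n u)\<^sub>+\<close>, which tends to \<open>\<psi>\<close> on the zero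
  set \<open>Z\<close> of \<open>u\<close> and to \<open>0\<close> elsewhere, gives in the limit that the integral of \<open>u(y) \<psi>(x)\<close> against
  the Gagliardo kernel over \<open>Z \<times> (- Z)\<close> vanishes, so \<open>\<psi> = 0\<close> almost everywhere on \<open>Z\<close>. The
  truncated translates of \<open>u\<close> itself serve as \<open>\<psi>\<close>: every translate of \<open>u\<close> vanishes almost
  everywhere on \<open>Z\<close>, and Fubini's theorem in the translation parameter makes \<open>Z\<close> a null set.

  Everything rests on the fractional Sobolev inequality (\<open>fractional_Sobolev\<close>). As elements
  of \<open>Hdot s\<close> lie in \<open>L\<^sup>p\<close> by definition, there is a short proof: \<open>|u x|\<close> is compared with the mean of \<open>u\<close> on
  balls around \<open>x\<close>, and the radius is optimised at each point.
\<close>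


section \<open>The semi-inner product space\<close>

abbreviation lebesgue2 :: "('a::euclidean_space \<times> 'a) measure" where
  "lebesgue2 \<equiv> lebesgue \<Otimes>\<^sub>M lebesgue"

lemma sigma_finite_lebesgue: "sigma_finite_measure (lebesgue :: 'a::euclidean_space measure)"
proof
  obtain A :: "'a set set" where A: "countable A" "A \<subseteq> sets lborel" "\<Union>A = space lborel"
      "\<forall>a\<in>A. emeasure lborel a \<noteq> \<infinity>"
    using lborel.sigma_finite_countable by blast
  show "\<exists>A :: 'a set set. countable A \<and> A \<subseteq> sets lebesgue \<and> \<Union>A = space lebesgue \<and>
      (\<forall>a\<in>A. emeasure lebesgue a \<noteq> \<infinity>)"
    using A by (intro exI[of _ A]) auto
qed

interpretation lebesgue: sigma_finite_measure "lebesgue :: 'a::euclidean_space measure"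
  by (rule sigma_finite_lebesgue)

interpretation lebesgue2: pair_sigma_finite "lebesgue :: 'a::euclidean_space measure"
    "lebesgue :: 'a::euclidean_space measure"
  by (rule pair_sigma_finite.intro) (rule sigma_finite_lebesgue)+

lemma norm_diff_measurable_lebesgue2 [measurable]:
  "(\<lambda>(x, y). norm (x - y :: 'a::euclidean_space)) \<in> borel_measurable lebesgue2"
proof -
  have "(\<lambda>x. x) \<in> borel_measurable (lebesgue :: 'a measure)"
    by (rule measurable_completion) simp
  then show ?thesis by measurable
qed

lemma gagliardo_integrand_measurable [measurable]:
  assumes [measurable]: "u \<in> borel_measurable lebesgue" "v \<in> borel_measurable lebesgue"
  shows "gagliardo_integrand s u v \<in> borel_measurable lebesgue2"
  unfolding gagliardo_integrand_def by measurable

lemma HdotD: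
  fixes u :: "'a::euclidean_space \<Rightarrow> real"
  assumes "u \<in> Hdot s"
  shows "u \<in> borel_measurable lebesgue"
    and "integrable lebesgue (\<lambda>x. \<bar>u x\<bar> powr crit_exp DIM('a) s)"
    and "integrable lebesgue2 (gagliardo_integrand s u u)"
  using assms by (auto simp: Hdot_def)

lemma gagliardo_integrable:
  assumes "u \<in> Hdot s" "v \<in> Hdot s"
  shows "integrable lebesgue2 (gagliardo_integrand s u v)"
proof (rule Bochner_Integration.integrable_bound)
  show "integrable lebesgue2 (\<lambda>z. gagliardo_integrand s u u z + gagliardo_integrand s v v z)"
    using assms by (intro Bochner_Integration.integrable_add HdotD)
  show "gagliardo_integrand s u v \<in> borel_measurable lebesgue2"
    using assms by (intro gagliardo_integrand_measurable HdotD)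
  have "\<bar>a * b\<bar> \<le> a * a + b * b" for a b :: real
  proof -
    have "2 * (\<bar>a\<bar> * \<bar>b\<bar>) \<le> a * a + b * b"
      using sum_squares_bound[of "\<bar>a\<bar>" "\<bar>b\<bar>"] by (simp add: power2_eq_square)
    moreover have "0 \<le> \<bar>a\<bar> * \<bar>b\<bar>" by simp
    ultimately show ?thesis unfolding abs_mult by linarith
  qed
  then show "AE z in lebesgue2. norm (gagliardo_integrand s u v z) \<le>
      norm (gagliardo_integrand s u u z + gagliardo_integrand s v v z)"
    by (intro AE_I2)
       (auto simp: gagliardo_integrand_def simp flip: add_divide_distrib intro!: divide_right_mono)
qed

lemma powr_add_le:
  fixes x y :: real
  assumes "0 \<le> p" "0 \<le> x" "0 \<le> y"
  shows "(x + y) powr p \<le> 2 powr p * (x powr p + y powr p)"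
proof -
  have "(x + y) powr p \<le> (2 * max x y) powr p"
    using assms by (intro powr_mono2) auto
  also have "\<dots> = 2 powr p * (max x y) powr p"
    using assms by (simp add: powr_mult)
  also have "\<dots> \<le> 2 powr p * (x powr p + y powr p)"
    by (intro mult_left_mono) (auto simp: max_def)
  finally show ?thesis .
qed

text \<open>
  The truncations and products used as test functions below all satisfy such pointwise bounds
  by two known elements of the space, which is the quickest way to see that they belong to it.
\<close>

lemma Hdot_dominated:
  fixes u v w :: "'a::euclidean_space \<Rightarrow> real"
  assumes u: "u \<in> Hdot s" and v: "v \<in> Hdot s" and [measurable]: "w \<in> borel_measurable lebesgue"
    and s: "0 < s" "2 * s < real DIM('a)"
    and le: "\<And>x. \<bar>w x\<bar> \<le> \<bar>u x\<bar> + \<bar>v x\<bar>"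
    and diff: "\<And>x y. \<bar>w x - w y\<bar> \<le> \<bar>u x - u y\<bar> + \<bar>v x - v y\<bar>"
  shows "w \<in> Hdot s"
proof -
  define p where "p = crit_exp DIM('a) s"
  have p: "p > 0" using s by (auto simp: p_def crit_exp_def)
  have "integrable lebesgue (\<lambda>x. \<bar>w x\<bar> powr p)"
  proof (rule Bochner_Integration.integrable_bound)
    show "integrable lebesgue (\<lambda>x. 2 powr p * (\<bar>u x\<bar> powr p + \<bar>v x\<bar> powr p))"
      using HdotD[OF u] HdotD[OF v] by (simp add: p_def)
    have "\<bar>w x\<bar> powr p \<le> 2 powr p * (\<bar>u x\<bar> powr p + \<bar>v x\<bar> powr p)" for x
    proof -
      have "\<bar>w x\<bar> powr p \<le> (\<bar>u x\<bar> + \<bar>v x\<bar>) powr p"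
        using le[of x] p by (intro powr_mono2) auto
      also have "\<dots> \<le> 2 powr p * (\<bar>u x\<bar> powr p + \<bar>v x\<bar> powr p)"
        using p by (intro powr_add_le) auto
      finally show ?thesis .
    qed
    then show "AE x in lebesgue. norm (\<bar>w x\<bar> powr p) \<le>
        norm (2 powr p * (\<bar>u x\<bar> powr p + \<bar>v x\<bar> powr p))" by simp
  qed measurable
  moreover have "integrable lebesgue2 (gagliardo_integrand s w w)"
  proof (rule Bochner_Integration.integrable_bound)
    show "integrable lebesgue2
        (\<lambda>z. 2 * (gagliardo_integrand s u u z + gagliardo_integrand s v v z))"
      using HdotD[OF u] HdotD[OF v] by simp
    have "d * d \<le> 2 * (b * b + c * c)" if "\<bar>d\<bar> \<le> \<bar>b\<bar> + \<bar>c\<bar>" for b c d :: real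
    proof -
      have "\<bar>d\<bar> * \<bar>d\<bar> \<le> (\<bar>b\<bar> + \<bar>c\<bar>) * (\<bar>b\<bar> + \<bar>c\<bar>)" using that by (intro mult_mono) auto
      also have "\<dots> \<le> 2 * (\<bar>b\<bar> * \<bar>b\<bar> + \<bar>c\<bar> * \<bar>c\<bar>)"
        using sum_squares_bound[of "\<bar>b\<bar>" "\<bar>c\<bar>"] by (simp add: algebra_simps power2_eq_square)
      finally show ?thesis by simp
    qed
    from this[OF diff] show "AE z in lebesgue2. norm (gagliardo_integrand s w w z) \<le>
        norm (2 * (gagliardo_integrand s u u z + gagliardo_integrand s v v z))"
      by (intro AE_I2)
        (auto simp: gagliardo_integrand_def simp flip: add_divide_distrib intro!: divide_right_mono)
  qed measurable
  ultimately show ?thesis by (simp add: Hdot_def p_def)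
qed

lemma Hdot_scale:
  fixes u :: "'a::euclidean_space \<Rightarrow> real"
  assumes u: "u \<in> Hdot s"
  shows "(\<lambda>x. c * u x) \<in> Hdot s"
proof -
  have [measurable]: "u \<in> borel_measurable lebesgue" by (rule HdotD[OF u])
  have "gagliardo_integrand s (\<lambda>x. c * u x) (\<lambda>x. c * u x) = (\<lambda>z. c\<^sup>2 * gagliardo_integrand s u u z)"
    by (auto simp: gagliardo_integrand_def fun_eq_iff power2_eq_square algebra_simps diff_divide_distrib add_divide_distrib)
  then show ?thesis using HdotD(2,3)[OF u] by (simp add: Hdot_def abs_mult powr_mult)
qed

lemma Hdot_add:
  fixes u :: "'a::euclidean_space \<Rightarrow> real"
  assumes u: "u \<in> Hdot s" and v: "v \<in> Hdot s" and s: "0 < s" "2 * s < real DIM('a)"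
  shows "(\<lambda>x. u x + v x) \<in> Hdot s"
  using HdotD(1)[OF u] HdotD(1)[OF v] by (intro Hdot_dominated[OF u v _ s]) auto

lemma Hdot_diff:
  fixes u :: "'a::euclidean_space \<Rightarrow> real"
  assumes u: "u \<in> Hdot s" and v: "v \<in> Hdot s" and s: "0 < s" "2 * s < real DIM('a)"
  shows "(\<lambda>x. u x - v x) \<in> Hdot s"
  using HdotD(1)[OF u] HdotD(1)[OF v] by (intro Hdot_dominated[OF u v _ s]) auto

lemma Hdot_zero: "(\<lambda>x. 0) \<in> Hdot s"
  by (simp add: Hdot_def gagliardo_integrand_def case_prod_unfold)

lemma form_commute: "gagliardo_form s u v = gagliardo_form s v u"
  by (simp add: gagliardo_form_def gagliardo_integrand_def mult.commute)

lemma form_add_left: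
  assumes "u \<in> Hdot s" "v \<in> Hdot s" "w \<in> Hdot s"
  shows "gagliardo_form s (\<lambda>x. u x + v x) w = gagliardo_form s u w + gagliardo_form s v w"
proof -
  have "gagliardo_integrand s (\<lambda>x. u x + v x) w =
      (\<lambda>z. gagliardo_integrand s u w z + gagliardo_integrand s v w z)"
    by (auto simp: gagliardo_integrand_def fun_eq_iff algebra_simps diff_divide_distrib add_divide_distrib)
  then show ?thesis using assms by (simp add: gagliardo_form_def gagliardo_integrable)
qed

lemma form_scale_left: "gagliardo_form s (\<lambda>x. c * u x) w = c * gagliardo_form s u w"
proof -
  have "gagliardo_integrand s (\<lambda>x. c * u x) w = (\<lambda>z. c * gagliardo_integrand s u w z)"
    by (auto simp: gagliardo_integrand_def fun_eq_iff algebra_simps diff_divide_distrib)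
  then show ?thesis by (simp add: gagliardo_form_def)
qed

lemma form_nonneg: "0 \<le> gagliardo_form s u u"
  unfolding gagliardo_form_def
  by (intro Bochner_Integration.integral_nonneg) (auto simp: gagliardo_integrand_def)

text \<open>
  The Cauchy-Schwarz inequality, the midpoint inequality for the energy and its first variation are
  all read off from this expansion.
\<close>

lemma form_sq_add_scaled:
  fixes u :: "'a::euclidean_space \<Rightarrow> real"
  assumes u: "u \<in> Hdot s" and v: "v \<in> Hdot s" and s: "0 < s" "2 * s < real DIM('a)"
  shows "gagliardo_form s (\<lambda>x. u x + t * v x) (\<lambda>x. u x + t * v x) =
    gagliardo_form s u u + 2 * t * gagliardo_form s u v + t\<^sup>2 * gagliardo_form s v v"
proof -
  note tv = Hdot_scale[OF v, of t] and utv = Hdot_add[OF u Hdot_scale[OF v, of t] s]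
  have *: "gagliardo_form s w (\<lambda>x. u x + t * v x) = gagliardo_form s w u + t * gagliardo_form s w v"
    if "w \<in> Hdot s" for w
    using form_add_left[OF u tv that] form_commute[of s w] form_scale_left[of s t v w] by metis
  show ?thesis
    using form_add_left[OF u tv utv] *[OF u] *[OF v] form_commute[of s u v]
    by (simp add: form_scale_left algebra_simps power2_eq_square)
qed

lemma Hdot_norm_sq: "(Hdot_norm s u)\<^sup>2 = gagliardo_form s u u"
  by (simp add: Hdot_norm_def form_nonneg)

lemma Hdot_norm_nonneg: "0 \<le> Hdot_norm s u"
  by (simp add: Hdot_norm_def form_nonneg)

lemma Hdot_norm_scale: "Hdot_norm s (\<lambda>x. c * u x) = \<bar>c\<bar> * Hdot_norm s u"
proof -
  have "gagliardo_form s (\<lambda>x. c * u x) (\<lambda>x. c * u x) = c\<^sup>2 * gagliardo_form s u u"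
    using form_commute[of s u "\<lambda>x. c * u x"] by (simp add: form_scale_left power2_eq_square)
  then show ?thesis by (simp add: Hdot_norm_def real_sqrt_mult)
qed

lemma form_cauchy_schwarz:
  fixes u :: "'a::euclidean_space \<Rightarrow> real"
  assumes u: "u \<in> Hdot s" and v: "v \<in> Hdot s" and s: "0 < s" "2 * s < real DIM('a)"
  shows "\<bar>gagliardo_form s u v\<bar> \<le> Hdot_norm s u * Hdot_norm s v"
proof -
  let ?a = "gagliardo_form s v v" and ?b = "gagliardo_form s u v" and ?c = "gagliardo_form s u u"
  have q: "0 \<le> ?c + 2 * t * ?b + t\<^sup>2 * ?a" for t
    using form_nonneg[of s "\<lambda>x. u x + t * v x"] form_sq_add_scaled[OF u v s, of t] by simp
  have "?b\<^sup>2 \<le> ?c * ?a"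
  proof (cases "?a = 0")
    case True
    have "?b = 0"
    proof (rule ccontr)
      assume "?b \<noteq> 0"
      then have "?c + 2 * (- (?c + 1) / (2 * ?b)) * ?b = -1" by (simp add: field_simps)
      then show False using q[of "- (?c + 1) / (2 * ?b)"] True by simp
    qed
    then show ?thesis by (simp add: True)
  next
    case False
    then have a: "?a > 0" using form_nonneg[of s v] by simp
    have "0 \<le> ?a * (?c + 2 * (- ?b / ?a) * ?b + (- ?b / ?a)\<^sup>2 * ?a)"
      using a q[of "- ?b / ?a"] by simp
    also have "\<dots> = ?c * ?a - ?b\<^sup>2" using a by (simp add: field_simps power2_eq_square)
    finally show ?thesis by simp
  qed
  then have "sqrt (?b\<^sup>2) \<le> sqrt (?c * ?a)" by (rule real_sqrt_le_mono)
  then show ?thesis by (simp add: Hdot_norm_def real_sqrt_mult)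
qed

lemma Hdot_norm_triangle:
  fixes u :: "'a::euclidean_space \<Rightarrow> real"
  assumes u: "u \<in> Hdot s" and v: "v \<in> Hdot s" and s: "0 < s" "2 * s < real DIM('a)"
  shows "Hdot_norm s (\<lambda>x. u x + v x) \<le> Hdot_norm s u + Hdot_norm s v"
proof (rule power2_le_imp_le)
  have "(Hdot_norm s (\<lambda>x. u x + v x))\<^sup>2 = (Hdot_norm s u)\<^sup>2 + 2 * gagliardo_form s u v + (Hdot_norm s v)\<^sup>2"
    using form_sq_add_scaled[OF u v s, of 1] by (simp add: Hdot_norm_sq)
  also have "\<dots> \<le> (Hdot_norm s u + Hdot_norm s v)\<^sup>2"
    using form_cauchy_schwarz[OF u v s] by (simp add: power2_sum)
  finally show "(Hdot_norm s (\<lambda>x. u x + v x))\<^sup>2 \<le> (Hdot_norm s u + Hdot_norm s v)\<^sup>2" .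
qed (simp add: Hdot_norm_nonneg)

section \<open>Hoelder's inequality\<close>

lemma powr_young:
  fixes x y :: real
  assumes "0 < \<alpha>" "0 < \<beta>" "\<alpha> + \<beta> = p"
  shows "\<bar>x\<bar> powr \<alpha> * \<bar>y\<bar> powr \<beta> \<le> \<alpha> / p * \<bar>x\<bar> powr p + \<beta> / p * \<bar>y\<bar> powr p"
proof (cases "x = 0 \<or> y = 0")
  case False
  have "(\<bar>x\<bar> powr p) powr (\<alpha> / p) * (\<bar>y\<bar> powr p) powr (\<beta> / p) \<le> \<alpha> / p * \<bar>x\<bar> powr p + \<beta> / p * \<bar>y\<bar> powr p"
    using assms False by (intro Youngs_inequality_0) (auto simp: field_simps)
  moreover have "p > 0" using assms by simp
  ultimately show ?thesis by (simp add: powr_powr)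
qed (use assms in auto)

text \<open>
  Homogeneous form with \<open>\<alpha> + \<beta> = p\<close>: the functions \<open>|f|\<close> and \<open>|g|\<close> are normalised in \<open>L\<^sup>p\<close> and Young's inequality is
  integrated. The exponents \<open>(p - 1, 1)\<close> and \<open>(p - 2, 2)\<close> control the first and the second variation of
  the critical term, \<open>(1, 1)\<close> and \<open>(p - 1, 1)\<close> with an indicator function control means over balls.
\<close>

lemma Hoelder_powr:
  fixes f g :: "'a \<Rightarrow> real"
  assumes [measurable]: "f \<in> borel_measurable M" "g \<in> borel_measurable M"
    and \<alpha>\<beta>: "0 < \<alpha>" "0 < \<beta>" "\<alpha> + \<beta> = p"
    and f: "integrable M (\<lambda>x. \<bar>f x\<bar> powr p)" and g: "integrable M (\<lambda>x. \<bar>g x\<bar> powr p)"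
  shows "integrable M (\<lambda>x. \<bar>f x\<bar> powr \<alpha> * \<bar>g x\<bar> powr \<beta>)" (is ?int)
    and "(LINT x|M. \<bar>f x\<bar> powr \<alpha> * \<bar>g x\<bar> powr \<beta>) \<le>
      (LINT x|M. \<bar>f x\<bar> powr p) powr (\<alpha> / p) * (LINT x|M. \<bar>g x\<bar> powr p) powr (\<beta> / p)" (is ?le)
proof -
  have p: "p > 0" using \<alpha>\<beta> by simp
  show int: ?int
  proof (rule Bochner_Integration.integrable_bound)
    show "integrable M (\<lambda>x. \<alpha> / p * \<bar>f x\<bar> powr p + \<beta> / p * \<bar>g x\<bar> powr p)"
      using f g by simp
    show "AE x in M. norm (\<bar>f x\<bar> powr \<alpha> * \<bar>g x\<bar> powr \<beta>)
        \<le> norm (\<alpha> / p * \<bar>f x\<bar> powr p + \<beta> / p * \<bar>g x\<bar> powr p)"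
      using powr_young[OF \<alpha>\<beta>] \<alpha>\<beta> by (intro AE_I2) (simp add: order_trans[OF _ abs_ge_self])
  qed measurable
  define A B where "A = (LINT x|M. \<bar>f x\<bar> powr p)" and "B = (LINT x|M. \<bar>g x\<bar> powr p)"
  have AB: "0 \<le> A" "0 \<le> B" unfolding A_def B_def by (auto intro!: Bochner_Integration.integral_nonneg)
  have vanish: "AE x in M. h x = 0" if "integrable M (\<lambda>x. \<bar>h x\<bar> powr p)" "(LINT x|M. \<bar>h x\<bar> powr p) = 0"
    for h :: "'a \<Rightarrow> real"
    using integral_nonneg_eq_0_iff_AE[OF that(1)] that(2) p by simp
  show ?le
  proof (cases "A = 0 \<or> B = 0")
    case True
    then have "AE x in M. \<bar>f x\<bar> powr \<alpha> * \<bar>g x\<bar> powr \<beta> = 0"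
      using vanish[OF f] vanish[OF g] \<alpha>\<beta> unfolding A_def B_def by (auto elim!: eventually_mono)
    then have "(LINT x|M. \<bar>f x\<bar> powr \<alpha> * \<bar>g x\<bar> powr \<beta>) = 0"
      by (rule integral_eq_zero_AE)
    then show ?thesis by simp
  next
    case False
    with AB have AB: "A > 0" "B > 0" by auto
    define a b where "a = A powr (1 / p)" and "b = B powr (1 / p)"
    have ab: "a > 0" "b > 0" using AB by (auto simp: a_def b_def)
    have pw: "a powr p = A" "b powr p = B" "a powr \<alpha> = A powr (\<alpha> / p)" "b powr \<beta> = B powr (\<beta> / p)"
      using AB p by (auto simp: a_def b_def powr_powr)
    have "\<bar>f x\<bar> powr \<alpha> * \<bar>g x\<bar> powr \<beta> \<le>
        (a powr \<alpha> * b powr \<beta>) * (\<alpha> / p * (\<bar>f x\<bar> powr p / A) + \<beta> / p * (\<bar>g x\<bar> powr p / B))" for x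
    proof -
      have "(\<bar>f x\<bar> powr \<alpha> * \<bar>g x\<bar> powr \<beta>) / (a powr \<alpha> * b powr \<beta>) \<le>
          \<alpha> / p * (\<bar>f x\<bar> powr p / A) + \<beta> / p * (\<bar>g x\<bar> powr p / B)"
        using powr_young[OF \<alpha>\<beta>, of "f x / a" "g x / b"] ab by (simp add: powr_divide pw)
      then show ?thesis
        using ab by (subst (asm) pos_divide_le_eq) (auto simp: mult.commute)
    qed
    then have "(LINT x|M. \<bar>f x\<bar> powr \<alpha> * \<bar>g x\<bar> powr \<beta>) \<le>
        (LINT x|M. (a powr \<alpha> * b powr \<beta>) * (\<alpha> / p * (\<bar>f x\<bar> powr p / A) + \<beta> / p * (\<bar>g x\<bar> powr p / B)))"
      using f g int by (intro integral_mono) auto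
    also have "\<dots> = (a powr \<alpha> * b powr \<beta>) * (\<alpha> / p * (A / A) + \<beta> / p * (B / B))"
      unfolding A_def B_def using f g by simp
    also have "\<dots> = a powr \<alpha> * b powr \<beta>"
      using AB \<alpha>\<beta> p by (simp flip: add_divide_distrib)
    finally show ?thesis unfolding pw A_def B_def .
  qed
qed

section \<open>The fractional Sobolev inequality\<close>

text \<open>
  Averaging \<open>|u x| \<le> |u y| + |u x - u y|\<close> over \<open>y\<close> in the ball. In the second term the kernel is at least the
  value that it takes for \<open>|x - y| = r\<close>, so the Cauchy-Schwarz inequality brings in the inner Gagliardo integral at \<open>x\<close>.
\<close>

lemma ball_mean_bound:
  fixes u :: "'a::euclidean_space \<Rightarrow> real"
  assumes [measurable]: "u \<in> borel_measurable lebesgue"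
    and s: "0 < s" and p: "1 < p"
    and u: "integrable lebesgue (\<lambda>y. \<bar>u y\<bar> powr p)"
    and D: "integrable lebesgue (\<lambda>y. (u x - u y) * (u x - u y) / norm (x - y) powr (real DIM('a) + 2 * s))"
      (is "integrable _ ?k")
    and r: "0 < r"
  defines "b \<equiv> measure lebesgue (ball x r)"
  shows "b * \<bar>u x\<bar> \<le> b powr ((p - 1) / p) * (LINT y|lebesgue. \<bar>u y\<bar> powr p) powr (1 / p)
     + b powr (1 / 2) * (r powr (real DIM('a) + 2 * s) *
        (LINT y|lebesgue. (u x - u y) * (u x - u y) / norm (x - y) powr (real DIM('a) + 2 * s))) powr (1 / 2)"
proof -
  let ?B = "ball x r" and ?I = "indicat_real (ball x r)"
  let ?e = "real DIM('a) + 2 * s"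
  have fin: "integrable lebesgue ?I" "(LINT y|lebesgue. ?I y) = b"
    using lmeasurable_ball[of x r] by (auto simp: b_def lmeasurable_iff_integrable)
  have Ip: "?I y powr q = ?I y" "\<bar>?I y\<bar> = ?I y" for y q by (auto simp: indicator_def)
  have 1: "integrable lebesgue (\<lambda>y. ?I y * \<bar>u y\<bar>)"
    "(LINT y|lebesgue. ?I y * \<bar>u y\<bar>) \<le> b powr ((p - 1) / p) * (LINT y|lebesgue. \<bar>u y\<bar> powr p) powr (1 / p)"
    using Hoelder_powr[of ?I lebesgue u "p - 1" 1 p] p u fin by (auto simp: Ip)
  define h where "h y = ?I y * (u x - u y)" for y
  have [measurable]: "?B \<in> sets lebesgue" by simp
  have [measurable]: "h \<in> borel_measurable lebesgue" unfolding h_def by measurable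
  have h: "\<bar>h y\<bar> powr 2 \<le> r powr ?e * ?k y" for y
  proof (cases "y \<in> ?B \<and> x \<noteq> y")
    case True
    then have n: "0 < norm (x - y)" "norm (x - y) < r" by (auto simp: dist_norm)
    have "(u x - u y)\<^sup>2 = norm (x - y) powr ?e * ?k y"
      using n by (simp add: power2_eq_square)
    also have "\<dots> \<le> r powr ?e * ?k y"
      using n s by (intro mult_right_mono powr_mono2) auto
    finally show ?thesis using True by (simp add: h_def)
  qed (auto simp: h_def)
  have hint: "integrable lebesgue (\<lambda>y. \<bar>h y\<bar> powr 2)"
    by (rule Bochner_Integration.integrable_bound[OF integrable_mult_right[OF D, of "r powr ?e"]])
      (use h in \<open>auto simp: abs_le_square_iff intro: order_trans[OF _ abs_ge_self]\<close>)
  have 2: "integrable lebesgue (\<lambda>y. ?I y * \<bar>h y\<bar>)"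
    "(LINT y|lebesgue. ?I y * \<bar>h y\<bar>) \<le> b powr (1 / 2) * (LINT y|lebesgue. \<bar>h y\<bar> powr 2) powr (1 / 2)"
    using Hoelder_powr[of ?I lebesgue h 1 1 2] hint fin by (auto simp: Ip simp del: powr_numeral)
  have 3: "(LINT y|lebesgue. \<bar>h y\<bar> powr 2) \<le> r powr ?e * (LINT y|lebesgue. ?k y)"
    using integral_mono[OF hint integrable_mult_right[OF D, of "r powr ?e"] h]
    by (simp only: integral_mult_right_zero)
  have "b * \<bar>u x\<bar> = (LINT y|lebesgue. ?I y * \<bar>u x\<bar>)" using fin by simp
  also have "\<dots> \<le> (LINT y|lebesgue. ?I y * \<bar>u y\<bar> + ?I y * \<bar>h y\<bar>)"
  proof (rule integral_mono)
    show "?I y * \<bar>u x\<bar> \<le> ?I y * \<bar>u y\<bar> + ?I y * \<bar>h y\<bar>" for y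
      by (auto simp: h_def indicator_def)
  qed (use fin 1(1) 2(1) in auto)
  also have "\<dots> = (LINT y|lebesgue. ?I y * \<bar>u y\<bar>) + (LINT y|lebesgue. ?I y * \<bar>h y\<bar>)"
    using 1 2 by simp
  also have "\<dots> \<le> b powr ((p - 1) / p) * (LINT y|lebesgue. \<bar>u y\<bar> powr p) powr (1 / p)
     + b powr (1 / 2) * (LINT y|lebesgue. \<bar>h y\<bar> powr 2) powr (1 / 2)"
    using 1 2 by simp
  also have "\<dots> \<le> b powr ((p - 1) / p) * (LINT y|lebesgue. \<bar>u y\<bar> powr p) powr (1 / p)
     + b powr (1 / 2) * (r powr ?e * (LINT y|lebesgue. ?k y)) powr (1 / 2)"
    by (intro add_left_mono mult_left_mono powr_mono2 3) (auto intro!: Bochner_Integration.integral_nonneg)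
  finally show ?thesis .
qed

text \<open>
  With \<open>\<omega>\<close> the volume of the unit ball, \<open>A = \<integral> |u|\<^sup>p\<close> and \<open>D\<close> the inner Gagliardo integral at a point \<open>x\<close>, the
  two terms bounding \<open>t = |u x|\<close> are multiples of \<open>r\<close> to the power \<open>-N/p\<close> and of \<open>r\<^sup>s\<close>. The radius that makes them
  equal yields a bound for \<open>|u x|\<^sup>p\<close> that is linear in \<open>D\<close>, hence integrable in \<open>x\<close>.
\<close>

lemma ball_optimal_radius:
  fixes N :: real
  assumes "0 < s" "2 * s < N" and p: "p = 2 * N / (N - 2 * s)" and pos: "0 < A" "0 < D" "0 < \<omega>" "0 \<le> t"
    and c: "c = max (\<omega> powr (- 1 / p)) (\<omega> powr (- 1 / 2))"
    and bound: "\<And>r. 0 < r \<Longrightarrow> (\<omega> * r powr N) * t \<le> (\<omega> * r powr N) powr ((p - 1) / p) * A powr (1 / p)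
      + (\<omega> * r powr N) powr (1 / 2) * (r powr (N + 2 * s) * D) powr (1 / 2)"
  shows "t powr p \<le> (2 * c) powr p * (A powr (1 - 2 / p) * D)"
proof -
  define r where "r = (A powr (1 / p) / D powr (1 / 2)) powr (2 / N)"
  have N: "N > 0" using assms by simp
  have p0: "p > 0" using assms by (auto simp: p)
  have pN: "N / p = N / 2 - s" using assms by (simp add: p field_simps)
  have r: "r > 0" using pos by (simp add: r_def)
  have lnr: "ln r = (2 / N) * (1 / p * ln A - 1 / 2 * ln D)"
    using pos by (simp add: r_def ln_powr ln_div ln_mult)
  define b where "b = \<omega> * r powr N"
  have b: "b > 0" using r pos by (simp add: b_def)
  have "t \<le> (b powr ((p - 1) / p) * A powr (1 / p) + b powr (1 / 2) * (r powr (N + 2 * s) * D) powr (1 / 2)) / b"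
    using bound[OF r] b by (simp add: b_def field_simps)
  also have "\<dots> = b powr (- 1 / p) * A powr (1 / p) + b powr (- 1 / 2) * (r powr (N + 2 * s) * D) powr (1 / 2)"
  proof -
    have "(p - 1) / p = 1 + (- 1 / p)" "1 / 2 = 1 + (- 1 / 2 :: real)" using p0 by (simp_all add: field_simps)
    then have "b powr ((p - 1) / p) = b * b powr (- 1 / p)" "b powr (1 / 2) = b * b powr (- 1 / 2)"
      using b powr_add[of b 1] by (metis powr_one less_imp_le)+
    then show ?thesis using b by (simp add: field_simps)
  qed
  also have "b powr (- 1 / p) * A powr (1 / p) = \<omega> powr (- 1 / p) * (r powr s * D powr (1 / 2))"
  proof -
    have "(N / p + s) * ln r = 1 / p * ln A - 1 / 2 * ln D"
      unfolding pN lnr using N by simp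
    then have "ln (r powr (- (N / p)) * A powr (1 / p)) = ln (r powr s * D powr (1 / 2))"
      using pos r by (simp add: ln_mult ln_powr algebra_simps)
    then have "r powr (- (N / p)) * A powr (1 / p) = r powr s * D powr (1 / 2)"
      using pos r by (subst (asm) ln_inj_iff) auto
    then show ?thesis using pos r by (simp add: b_def powr_mult powr_powr mult.assoc)
  qed
  also have "b powr (- 1 / 2) * (r powr (N + 2 * s) * D) powr (1 / 2) = \<omega> powr (- 1 / 2) * (r powr s * D powr (1 / 2))"
  proof -
    have "r powr (- (N / 2)) * r powr ((N + 2 * s) / 2) = r powr s"
      by (simp add: field_simps flip: powr_add)
    then show ?thesis using pos r by (simp add: b_def powr_mult powr_powr mult.assoc)
  qed
  also have "\<omega> powr (- 1 / p) * (r powr s * D powr (1 / 2)) + \<omega> powr (- 1 / 2) * (r powr s * D powr (1 / 2))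
      \<le> c * (r powr s * D powr (1 / 2)) + c * (r powr s * D powr (1 / 2))"
    unfolding c by (intro add_mono mult_right_mono) auto
  finally have "t \<le> (2 * c) * (r powr s * D powr (1 / 2))" by simp
  then have "t powr p \<le> ((2 * c) * (r powr s * D powr (1 / 2))) powr p"
    using pos p0 by (intro powr_mono2) auto
  also have "\<dots> = (2 * c) powr p * (r powr s * D powr (1 / 2)) powr p"
    using pos by (simp add: c powr_mult)
  also have "(r powr s * D powr (1 / 2)) powr p = A powr (1 - 2 / p) * D"
  proof -
    have e: "p * s / N = p / 2 - 1" using pN p0 N by (simp add: field_simps)
    have "ln ((r powr s * D powr (1 / 2)) powr p) = p * s * ln r + p / 2 * ln D"
      using pos r by (simp add: ln_mult ln_powr algebra_simps)
    also have "\<dots> = 2 * (p * s / N) * (1 / p * ln A - 1 / 2 * ln D) + p / 2 * ln D"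
      unfolding lnr by simp
    also have "\<dots> = ln (A powr (1 - 2 / p) * D)"
      unfolding e using pos p0 by (simp add: ln_mult ln_powr field_simps)
    finally show ?thesis using pos r by (subst (asm) ln_inj_iff) auto
  qed
  finally show ?thesis .
qed

lemma crit_exp_gt_2: "0 < s \<Longrightarrow> 2 * s < real N \<Longrightarrow> 2 < crit_exp N s"
  by (simp add: crit_exp_def field_simps)

text \<open>
  Integrating the pointwise bound over \<open>x\<close> bounds \<open>A\<close> by \<open>S \<cdot> [u]\<^sup>2\<close> times \<open>A\<close> to the power \<open>1 - 2/p\<close>.
  By definition of the space \<open>A\<close> is finite, so the power of \<open>A\<close> can be divided out.
\<close>

theorem fractional_Sobolev:
  assumes s: "0 < s" "2 * s < real DIM('a::euclidean_space)"
  obtains S where "0 < S"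
    "\<And>u :: 'a \<Rightarrow> real. u \<in> Hdot s \<Longrightarrow>
      (LINT x|lebesgue. \<bar>u x\<bar> powr crit_exp DIM('a) s) powr (2 / crit_exp DIM('a) s) \<le> S * gagliardo_form s u u"
proof -
  define N where "N = real DIM('a)"
  define p where "p = crit_exp DIM('a) s"
  have p2: "p > 2" using crit_exp_gt_2[OF s] by (simp add: p_def)
  define \<omega> where "\<omega> = unit_ball_vol N"
  have \<omega>: "\<omega> > 0" by (simp add: \<omega>_def N_def)
  define c where "c = max (\<omega> powr (- 1 / p)) (\<omega> powr (- 1 / 2))"
  have c: "c > 0" using \<omega> by (simp add: c_def less_max_iff_disj)
  define S where "S = (2 * c) powr p"
  have "(LINT x|lebesgue. \<bar>u x\<bar> powr p) powr (2 / p) \<le> S * gagliardo_form s u u" if u: "u \<in> Hdot s" for u :: "'a \<Rightarrow> real"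
  proof -
    define A where "A = (LINT x|lebesgue. \<bar>u x\<bar> powr p)"
    define D where "D x = (LINT y|lebesgue. gagliardo_integrand s u u (x, y))" for x
    note [measurable] = HdotD(1)[OF u]
    note u' = HdotD(2)[OF u, folded p_def]
    have A0: "A \<ge> 0" unfolding A_def by (auto intro!: Bochner_Integration.integral_nonneg)
    have D0: "D x \<ge> 0" for x
      unfolding D_def by (auto intro!: Bochner_Integration.integral_nonneg simp: gagliardo_integrand_def)
    show ?thesis
    proof (cases "A = 0")
      case True
      then show ?thesis using form_nonneg[of s u] c by (simp add: A_def S_def)
    next
      case False
      with A0 have A: "A > 0" by simp
      have point: "\<bar>u x\<bar> powr p \<le> S * (A powr (1 - 2 / p) * D x)"
        if int: "integrable lebesgue (\<lambda>y. gagliardo_integrand s u u (x, y))" for x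
      proof (rule field_le_epsilon)
        fix e :: real assume e: "e > 0"
        \<comment> \<open>The optimal radius is undefined when the Gagliardo integral at \<open>x\<close> vanishes, so the integral is increased slightly.\<close>
        define d where "d = e / (S * A powr (1 - 2 / p))"
        have S: "S * A powr (1 - 2 / p) > 0" using c A by (simp add: S_def)
        have d: "d > 0" using e S by (simp add: d_def)
        have "\<bar>u x\<bar> powr p \<le> (2 * c) powr p * (A powr (1 - 2 / p) * (D x + d))"
        proof (rule ball_optimal_radius[of s N p _ _ \<omega>])
          show "p = 2 * N / (N - 2 * s)" by (simp add: p_def N_def crit_exp_def)
          fix r :: real assume r: "r > 0"
          have b: "measure lebesgue (ball x r) = \<omega> * r powr N"
            using r by (simp add: content_ball \<omega>_def N_def powr_realpow)
          have "\<omega> * r powr N * \<bar>u x\<bar> \<le> (\<omega> * r powr N) powr ((p - 1) / p) * A powr (1 / p) +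
             (\<omega> * r powr N) powr (1 / 2) * (r powr (N + 2 * s) * D x) powr (1 / 2)"
            using ball_mean_bound[of u s p x r] s p2 u' r int unfolding b
            by (simp add: A_def D_def N_def gagliardo_integrand_def)
          also have "\<dots> \<le> (\<omega> * r powr N) powr ((p - 1) / p) * A powr (1 / p) +
             (\<omega> * r powr N) powr (1 / 2) * (r powr (N + 2 * s) * (D x + d)) powr (1 / 2)"
            using d D0[of x] by (intro add_left_mono mult_left_mono powr_mono2) auto
          finally show "\<omega> * r powr N * \<bar>u x\<bar> \<le> (\<omega> * r powr N) powr ((p - 1) / p) * A powr (1 / p) +
             (\<omega> * r powr N) powr (1 / 2) * (r powr (N + 2 * s) * (D x + d)) powr (1 / 2)" .
        qed (use s A d D0[of x] \<omega> in \<open>auto simp: N_def c_def\<close>)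
        also have "\<dots> = S * (A powr (1 - 2 / p) * D x) + e"
        proof -
          have "S * A powr (1 - 2 / p) * d = e"
            using S unfolding d_def times_divide_eq_right
            by (intro nonzero_mult_div_cancel_left less_imp_neq[symmetric])
          then show ?thesis by (simp add: S_def algebra_simps)
        qed
        finally show "\<bar>u x\<bar> powr p \<le> S * (A powr (1 - 2 / p) * D x) + e" .
      qed
      have DI: "integrable lebesgue D" "(LINT x|lebesgue. D x) = gagliardo_form s u u"
        unfolding D_def gagliardo_form_def
        using lebesgue2.integrable_fst'[OF HdotD(3)[OF u]] lebesgue2.integral_fst'[OF HdotD(3)[OF u]] by auto
      have "A = (LINT x|lebesgue. \<bar>u x\<bar> powr p)" by (rule A_def)
      also have "\<dots> \<le> (LINT x|lebesgue. S * (A powr (1 - 2 / p) * D x))"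
        using u' DI point lebesgue2.AE_integrable_fst'[OF HdotD(3)[OF u]]
        by (intro integral_mono_AE) (auto elim!: eventually_mono)
      also have "\<dots> = S * (A powr (1 - 2 / p) * gagliardo_form s u u)" using DI by simp
      finally have "A \<le> S * (A powr (1 - 2 / p) * gagliardo_form s u u)" .
      then have "A powr (2 / p) \<le> S * gagliardo_form s u u"
        using A by (simp add: powr_diff field_simps)
      then show ?thesis by (simp add: A_def)
    qed
  qed
  moreover have "S > 0" using c by (simp add: S_def)
  ultimately show ?thesis using that p_def by blast
qed

section \<open>Completeness\<close>

text \<open>
  Cylinders over null sets are null, also for the product measure that is not completed.
\<close>

lemma AE_lebesgue2:
  assumes "AE x in (lebesgue :: 'a::euclidean_space measure). P x"
  shows "AE z in lebesgue2. P (fst z) \<and> P (snd z)"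
proof -
  obtain N where N: "N \<in> null_sets (lebesgue :: 'a measure)" "{x \<in> space lebesgue. \<not> P x} \<subseteq> N"
    using assms by (auto simp: eventually_ae_filter)
  have "N \<times> UNIV \<in> null_sets lebesgue2" "UNIV \<times> N \<in> null_sets (lebesgue2 :: ('a \<times> 'a) measure)"
    using N(1) lebesgue.emeasure_pair_measure_Times[of N lebesgue UNIV]
      lebesgue.emeasure_pair_measure_Times[of UNIV lebesgue N]
    by (auto simp: null_sets_def)
  then have "N \<times> UNIV \<union> UNIV \<times> N \<in> null_sets lebesgue2" by (rule null_sets.Un)
  then show ?thesis by (rule AE_I') (use N(2) in auto)
qed

lemma Fatou_integrable:
  fixes f :: "'b \<Rightarrow> real"
  assumes [measurable]: "f \<in> borel_measurable M" and g: "\<And>j. integrable M (g j)"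
    and nonneg: "\<And>j x. 0 \<le> g j x" "\<And>x. 0 \<le> f x"
    and lim: "AE x in M. (\<lambda>j. g j x) \<longlonglongrightarrow> f x"
    and B: "eventually (\<lambda>j. integral\<^sup>L M (g j) \<le> B) sequentially"
  shows "integrable M f" "integral\<^sup>L M f \<le> B"
proof -
  have [measurable]: "g j \<in> borel_measurable M" for j using g by auto
  have "(\<integral>\<^sup>+x. ennreal (f x) \<partial>M) = (\<integral>\<^sup>+x. liminf (\<lambda>j. ennreal (g j x)) \<partial>M)"
    using lim by (intro nn_integral_cong_AE) (auto elim!: eventually_mono intro!: lim_imp_Liminf[symmetric] tendsto_ennrealI)
  also have "\<dots> \<le> liminf (\<lambda>j. \<integral>\<^sup>+x. ennreal (g j x) \<partial>M)"
    by (intro nn_integral_liminf) auto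
  also have "\<dots> = liminf (\<lambda>j. ennreal (integral\<^sup>L M (g j)))"
    using g nonneg by (simp add: nn_integral_eq_integral)
  also have "\<dots> \<le> limsup (\<lambda>j. ennreal (integral\<^sup>L M (g j)))"
    by (simp add: Liminf_le_Limsup)
  also have "\<dots> \<le> ennreal B"
    using B by (intro Limsup_bounded) (auto elim!: eventually_mono intro: ennreal_leI)
  finally have le: "(\<integral>\<^sup>+x. ennreal (f x) \<partial>M) \<le> ennreal B" .
  then show "integrable M f"
    using nonneg by (intro integrableI_nonneg) (auto simp: order_le_less_trans)
  obtain j where "integral\<^sup>L M (g j) \<le> B" using eventually_happens[OF B] by auto
  moreover have "0 \<le> integral\<^sup>L M (g j)" by (intro Bochner_Integration.integral_nonneg nonneg)
  ultimately have "0 \<le> B" by linarith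
  with le show "integral\<^sup>L M f \<le> B"
    using nonneg nn_integral_eq_integral[OF \<open>integrable M f\<close>] by simp
qed

text \<open>
  The functions \<open>(2\<^sup>k |w\<^sub>k\<^sub>+\<^sub>1 - w\<^sub>k|)\<^sup>p\<close> have summable integrals, so at almost every point they tend to \<open>0\<close>. There the
  increments are eventually at most \<open>2\<close> to the power \<open>-k\<close>.
\<close>

lemma AE_convergent_fast_subsequence:
  fixes w :: "nat \<Rightarrow> 'b \<Rightarrow> real"
  assumes p: "0 < p" and [measurable]: "\<And>k. w k \<in> borel_measurable M"
    and int: "\<And>k. integrable M (\<lambda>x. \<bar>w (Suc k) x - w k x\<bar> powr p)"
    and fast: "\<And>k. (LINT x|M. \<bar>w (Suc k) x - w k x\<bar> powr p) \<le> (1 / 2) ^ k * ((1 / 2) ^ k) powr p"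
  shows "AE x in M. convergent (\<lambda>k. w k x)"
proof -
  define g where "g k x = (2 ^ k) powr p * \<bar>w (Suc k) x - w k x\<bar> powr p" for k x
  have [measurable]: "g k \<in> borel_measurable M" for k unfolding g_def by measurable
  have "(\<integral>\<^sup>+x. (\<Sum>k. ennreal (g k x)) \<partial>M) = (\<Sum>k. \<integral>\<^sup>+x. ennreal (g k x) \<partial>M)"
    by (intro nn_integral_suminf) simp
  also have "\<dots> \<le> (\<Sum>k. ennreal ((1 / 2) ^ k))"
  proof (intro suminf_le allI)
    fix k
    have "(2 ^ k) powr p * ((1 / 2) ^ k) powr p = (1 :: real)"
      by (simp add: power_one_over flip: powr_mult)
    then have "(2 ^ k) powr p * (LINT x|M. \<bar>w (Suc k) x - w k x\<bar> powr p) \<le> (1 / 2) ^ k"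
      using mult_left_mono[OF fast[of k], of "(2 ^ k) powr p"] by (simp add: algebra_simps)
    then show "(\<integral>\<^sup>+x. ennreal (g k x) \<partial>M) \<le> ennreal ((1 / 2) ^ k)"
      using int[of k] by (subst nn_integral_eq_integral) (auto simp: g_def[abs_def] intro!: ennreal_leI)
  qed auto
  also have "\<dots> < \<infinity>"
    using summable_geometric[of "1 / 2 :: real"]
    by (subst suminf_ennreal2) (auto simp: ennreal_less_top)
  finally have "AE x in M. (\<Sum>k. ennreal (g k x)) \<noteq> \<infinity>"
    by (intro nn_integral_noteq_infinite) auto
  then show ?thesis
  proof (rule AE_mp, intro AE_I2 impI)
    fix x assume "(\<Sum>k. ennreal (g k x)) \<noteq> \<infinity>"
    then have "summable (\<lambda>k. g k x)"
      by (intro summable_suminf_not_top) (auto simp: g_def)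
    then have "eventually (\<lambda>k. g k x < 1) sequentially"
      using summable_LIMSEQ_zero order_tendstoD(2) by fastforce
    then have ev: "eventually (\<lambda>k. norm (w (Suc k) x - w k x) \<le> (1 / 2) ^ k) sequentially"
    proof (rule eventually_mono)
      fix k assume "g k x < 1"
      then have "(2 ^ k * \<bar>w (Suc k) x - w k x\<bar>) powr p < 1 powr p"
        by (simp add: g_def powr_mult)
      then have "2 ^ k * \<bar>w (Suc k) x - w k x\<bar> < 1"
        using p by (metis not_le powr_mono2 less_imp_le zero_le_one)
      then show "norm (w (Suc k) x - w k x) \<le> (1 / 2) ^ k"
        by (simp add: power_one_over field_simps)
    qed
    have "summable (\<lambda>k. w (Suc k) x - w k x)"
      using summable_comparison_test_ev[OF ev] summable_geometric[of "1 / 2 :: real"] by simp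
    then have "convergent (\<lambda>n. \<Sum>k<n. w (Suc k) x - w k x)"
      by (simp add: summable_iff_convergent)
    then have "convergent (\<lambda>n. (\<Sum>k<n. w (Suc k) x - w k x) + w 0 x)"
      by (intro convergent_add convergent_const)
    moreover have "(\<lambda>n. (\<Sum>k<n. w (Suc k) x - w k x) + w 0 x) = (\<lambda>k. w k x)"
      using sum_lessThan_telescope[of "\<lambda>k. w k x"] by (simp add: fun_eq_iff)
    ultimately show "convergent (\<lambda>k. w k x)" by simp
  qed
qed

lemma fractional_Sobolev_integral:
  assumes s: "0 < s" "2 * s < real DIM('a::euclidean_space)"
  obtains S where "0 < S"
    "\<And>u :: 'a \<Rightarrow> real. u \<in> Hdot s \<Longrightarrow>
      (LINT x|lebesgue. \<bar>u x\<bar> powr crit_exp DIM('a) s) \<le> S * Hdot_norm s u powr crit_exp DIM('a) s"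
proof -
  define p where "p = crit_exp DIM('a) s"
  have p2: "p > 2" using crit_exp_gt_2[OF s] by (simp add: p_def)
  obtain S where S: "0 < S" "\<And>u :: 'a \<Rightarrow> real. u \<in> Hdot s \<Longrightarrow>
      (LINT x|lebesgue. \<bar>u x\<bar> powr p) powr (2 / p) \<le> S * gagliardo_form s u u"
    using fractional_Sobolev[OF s] unfolding p_def by blast
  have "(LINT x|lebesgue. \<bar>u x\<bar> powr p) \<le> S powr (p / 2) * Hdot_norm s u powr p"
    if "u \<in> Hdot s" for u :: "'a \<Rightarrow> real"
  proof -
    let ?A = "LINT x|lebesgue. \<bar>u x\<bar> powr p"
    have "?A \<ge> 0" by (auto intro!: Bochner_Integration.integral_nonneg)
    then have "?A = (?A powr (2 / p)) powr (p / 2)" using p2 by (simp add: powr_powr)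
    also have "\<dots> \<le> (S * gagliardo_form s u u) powr (p / 2)"
      using S(2)[OF that] p2 by (intro powr_mono2) auto
    also have "\<dots> = S powr (p / 2) * (gagliardo_form s u u powr (1 / 2)) powr p"
      using S(1) form_nonneg[of s u] by (simp add: powr_mult powr_powr)
    also have "gagliardo_form s u u powr (1 / 2) = Hdot_norm s u"
      by (simp add: Hdot_norm_def powr_half_sqrt form_nonneg)
    finally show ?thesis .
  qed
  then show ?thesis using that[of "S powr (p / 2)"] S(1) by (simp add: p_def)
qed

text \<open>
  By the Sobolev inequality a Cauchy sequence is Cauchy in \<open>L\<^sup>p\<close>, so a subsequence converges almost
  everywhere. Fatou's lemma on the space and on its square shows that the limit belongs to the
  space and that the convergence holds in norm.
\<close>

theorem Hdot_complete:
  fixes w :: "nat \<Rightarrow> 'a::euclidean_space \<Rightarrow> real"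
  assumes s: "0 < s" "2 * s < real DIM('a)"
    and w: "\<And>n. w n \<in> Hdot s"
    and Cauchy: "\<And>e. 0 < e \<Longrightarrow> \<exists>M. \<forall>m\<ge>M. \<forall>n\<ge>M. Hdot_norm s (\<lambda>x. w m x - w n x) < e"
  obtains u where "u \<in> Hdot s" "(\<lambda>n. Hdot_norm s (\<lambda>x. w n x - u x)) \<longlonglongrightarrow> 0"
proof -
  define p where "p = crit_exp DIM('a) s"
  have p2: "p > 2" using crit_exp_gt_2[OF s] by (simp add: p_def)
  obtain S where S: "0 < S" "\<And>u :: 'a \<Rightarrow> real. u \<in> Hdot s \<Longrightarrow>
      (LINT x|lebesgue. \<bar>u x\<bar> powr p) \<le> S * Hdot_norm s u powr p"
    using fractional_Sobolev_integral[OF s] unfolding p_def by blast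
  have [measurable]: "w n \<in> borel_measurable lebesgue" for n by (rule HdotD[OF w])
  note wd = Hdot_diff[OF w w s]
  \<comment> \<open>Chosen so that the Sobolev inequality turns distance \<open>\<epsilon> k\<close> into the rate required for convergence almost everywhere.\<close>
  define \<epsilon> where "\<epsilon> k = ((1 / 2) ^ k * ((1 / 2) ^ k) powr p / S) powr (1 / p)" for k :: nat
  have \<epsilon>: "\<epsilon> k > 0" "\<epsilon> k powr p = (1 / 2) ^ k * ((1 / 2) ^ k) powr p / S" for k
    using S p2 by (auto simp: \<epsilon>_def powr_powr)
  obtain M where M: "Hdot_norm s (\<lambda>x. w m x - w n x) < \<epsilon> k" if "m \<ge> M k" "n \<ge> M k" for k m n
    using Cauchy[OF \<epsilon>(1)] by metis
  \<comment> \<open>The sum makes \<open>r\<close> monotone and at least \<open>M k\<close>; the summand \<open>k\<close> makes it unbounded.\<close>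
  define r where "r k = k + (\<Sum>i\<le>k. M i)" for k
  have r: "r k \<ge> k" "r k \<ge> M k" "r (Suc k) \<ge> r k" for k
    by (auto simp: r_def intro: order_trans[OF member_le_sum[of k "{..k}" M]])
  have "AE x in lebesgue. convergent (\<lambda>k. w (r k) x)"
  proof (rule AE_convergent_fast_subsequence[of p])
    fix k
    show "integrable lebesgue (\<lambda>x. \<bar>w (r (Suc k)) x - w (r k) x\<bar> powr p)"
      using HdotD(2)[OF wd] by (simp add: p_def)
    have "(LINT x|lebesgue. \<bar>w (r (Suc k)) x - w (r k) x\<bar> powr p) \<le>
        S * Hdot_norm s (\<lambda>x. w (r (Suc k)) x - w (r k) x) powr p"
      by (rule S(2)[OF wd])
    also have "\<dots> \<le> S * \<epsilon> k powr p"
      using M[of k "r (Suc k)" "r k"] r[of k] S p2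
      by (intro mult_left_mono powr_mono2) (auto simp: Hdot_norm_nonneg)
    also have "\<dots> = (1 / 2) ^ k * ((1 / 2) ^ k) powr p" using S by (simp add: \<epsilon>)
    finally show "(LINT x|lebesgue. \<bar>w (r (Suc k)) x - w (r k) x\<bar> powr p)
        \<le> (1 / 2) ^ k * ((1 / 2) ^ k) powr p" .
  qed (use p2 in auto)
  define u where "u x = lim (\<lambda>k. w (r k) x)" for x
  have [measurable]: "u \<in> borel_measurable lebesgue" unfolding u_def by measurable
  have lim: "AE x in lebesgue. (\<lambda>k. w (r k) x) \<longlonglongrightarrow> u x"
    using \<open>AE x in lebesgue. convergent (\<lambda>k. w (r k) x)\<close>
    by (rule eventually_mono) (simp add: u_def convergent_LIMSEQ_iff)
  have close: "(\<lambda>x. w m x - u x) \<in> Hdot s \<and> Hdot_norm s (\<lambda>x. w m x - u x) \<le> e"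
    if e: "0 < e" and K: "m \<ge> K" "\<forall>m\<ge>K. \<forall>n\<ge>K. Hdot_norm s (\<lambda>x. w m x - w n x) < e" for m K e
  proof -
    have ev: "eventually (\<lambda>j. Hdot_norm s (\<lambda>x. w m x - w (r j) x) \<le> e) sequentially"
      using eventually_ge_at_top[of K]
      by eventually_elim (use K r(1) order_trans in \<open>blast intro: less_imp_le\<close>)
    have "integrable lebesgue (\<lambda>x. \<bar>w m x - u x\<bar> powr p)"
    proof (rule Fatou_integrable)
      show "integrable lebesgue (\<lambda>x. \<bar>w m x - w (r j) x\<bar> powr p)" for j
        using HdotD(2)[OF wd] by (simp add: p_def)
      show "AE x in lebesgue. (\<lambda>j. \<bar>w m x - w (r j) x\<bar> powr p) \<longlonglongrightarrow> \<bar>w m x - u x\<bar> powr p"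
        using lim by eventually_elim (use p2 in \<open>intro tendsto_powr2 tendsto_intros; simp\<close>)
      show "eventually (\<lambda>j. (LINT x|lebesgue. \<bar>w m x - w (r j) x\<bar> powr p) \<le> S * e powr p) sequentially"
        using ev
      proof eventually_elim
        case (elim j)
        show ?case
          by (rule order_trans[OF S(2)[OF wd]])
            (use elim S p2 in \<open>intro mult_left_mono powr_mono2; auto simp: Hdot_norm_nonneg\<close>)
      qed
    qed auto
    moreover have "integrable lebesgue2 (gagliardo_integrand s (\<lambda>x. w m x - u x) (\<lambda>x. w m x - u x))"
      and "integral\<^sup>L lebesgue2 (gagliardo_integrand s (\<lambda>x. w m x - u x) (\<lambda>x. w m x - u x)) \<le> e\<^sup>2"
    proof -
      let ?g = "\<lambda>j. gagliardo_integrand s (\<lambda>x. w m x - w (r j) x) (\<lambda>x. w m x - w (r j) x)"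
      have 1: "integrable lebesgue2 (?g j)" for j by (rule HdotD(3)[OF wd])
      have 2: "AE z in lebesgue2. (\<lambda>j. ?g j z) \<longlonglongrightarrow> gagliardo_integrand s (\<lambda>x. w m x - u x) (\<lambda>x. w m x - u x) z"
        using AE_lebesgue2[OF lim]
        by eventually_elim
          (auto simp: gagliardo_integrand_def case_prod_unfold divide_inverse intro!: tendsto_intros)
      have 3: "eventually (\<lambda>j. integral\<^sup>L lebesgue2 (?g j) \<le> e\<^sup>2) sequentially"
        using ev
      proof eventually_elim
        case (elim j)
        have "(Hdot_norm s (\<lambda>x. w m x - w (r j) x))\<^sup>2 \<le> e\<^sup>2"
          using elim by (intro power_mono) (auto simp: Hdot_norm_nonneg)
        then show ?case by (simp add: Hdot_norm_sq gagliardo_form_def)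
      qed
      show "integrable lebesgue2 (gagliardo_integrand s (\<lambda>x. w m x - u x) (\<lambda>x. w m x - u x))"
        "integral\<^sup>L lebesgue2 (gagliardo_integrand s (\<lambda>x. w m x - u x) (\<lambda>x. w m x - u x)) \<le> e\<^sup>2"
        by (rule Fatou_integrable[OF _ 1 _ _ 2 3]; force simp: gagliardo_integrand_def)+
    qed
    ultimately show ?thesis
      using e by (simp add: Hdot_def p_def Hdot_norm_def gagliardo_form_def real_le_lsqrt)
  qed
  obtain K where K: "\<forall>m\<ge>K. \<forall>n\<ge>K. Hdot_norm s (\<lambda>x. w m x - w n x) < 1" using Cauchy[of 1] by auto
  have "(\<lambda>x. w K x - (w K x - u x)) \<in> Hdot s"
    by (rule Hdot_diff[OF w _ s]) (use close[OF zero_less_one order_refl K] in simp)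
  then have "u \<in> Hdot s" by simp
  moreover have "(\<lambda>n. Hdot_norm s (\<lambda>x. w n x - u x)) \<longlonglongrightarrow> 0"
  proof (rule LIMSEQ_I)
    fix e :: real assume e: "0 < e"
    obtain K where K: "\<forall>m\<ge>K. \<forall>n\<ge>K. Hdot_norm s (\<lambda>x. w m x - w n x) < e / 2" using Cauchy[of "e / 2"] e by auto
    have "norm (Hdot_norm s (\<lambda>x. w n x - u x) - 0) < e" if "n \<ge> K" for n
      using close[OF _ that K] e Hdot_norm_nonneg[of s "\<lambda>x. w n x - u x"] by simp
    then show "\<exists>K. \<forall>n\<ge>K. norm (Hdot_norm s (\<lambda>x. w n x - u x) - 0) < e" by blast
  qed
  ultimately show ?thesis by (rule that)
qed

section \<open>The truncated critical power\<close>

text \<open>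
  Convexity of \<open>t\<^sup>p\<close>, read off from Young's inequality; this covers the boundary point \<open>0\<close> as well.
\<close>

lemma powr_tangent_le:
  fixes x y :: real
  assumes "1 < p" "0 \<le> x" "0 \<le> y"
  shows "x powr p + p * x powr (p - 1) * (y - x) \<le> y powr p"
proof -
  have "x powr (p - 1) * x = x powr p" using assms by (cases "x = 0") (simp_all add: powr_diff)
  moreover have "x powr (p - 1) * y \<le> (p - 1) / p * x powr p + 1 / p * y powr p"
    using powr_young[of "p - 1" 1 p x y] assms by simp
  then have "p * (x powr (p - 1) * y) \<le> p * ((p - 1) / p * x powr p + 1 / p * y powr p)"
    using assms by (intro mult_left_mono) auto
  moreover have "p * ((p - 1) / p * x powr p + 1 / p * y powr p) = p * x powr p - x powr p + y powr p"
    using assms by (simp add: field_simps)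
  ultimately show ?thesis by (simp add: algebra_simps)
qed

lemma pos_part_powr_tangent_le:
  fixes x y :: real
  assumes p: "1 < p"
  shows "max 0 x powr p / p + max 0 x powr (p - 1) * (y - x) \<le> max 0 y powr p / p"
proof -
  have "max 0 x powr (p - 1) * (y - x) \<le> max 0 x powr (p - 1) * (max 0 y - max 0 x)"
    by (cases "x > 0") (auto intro!: mult_left_mono)
  moreover have "max 0 x powr p / p + max 0 x powr (p - 1) * (max 0 y - max 0 x) \<le> max 0 y powr p / p"
  proof -
    have "(max 0 x powr p + p * max 0 x powr (p - 1) * (max 0 y - max 0 x)) / p \<le> max 0 y powr p / p"
      using powr_tangent_le[OF p, of "max 0 x" "max 0 y"] p by (intro divide_right_mono) auto
    then show ?thesis using p by (simp add: add_divide_distrib mult.assoc)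
  qed
  ultimately show ?thesis by linarith
qed

lemma pos_part_powr_Lipschitz:
  fixes x y :: real
  assumes q: "1 < q"
  shows "(max 0 y powr q - max 0 x powr q) * (y - x) \<le> q * (\<bar>x\<bar> + \<bar>y\<bar>) powr (q - 1) * (y - x)\<^sup>2"
proof -
  have *: "(max 0 y powr q - max 0 x powr q) * (y - x) \<le> q * (\<bar>x\<bar> + \<bar>y\<bar>) powr (q - 1) * (y - x)\<^sup>2"
    if "x \<le> y" for x y :: real
  proof -
    have "max 0 y powr q - max 0 x powr q \<le> q * max 0 y powr (q - 1) * (max 0 y - max 0 x)"
      using powr_tangent_le[OF q, of "max 0 y" "max 0 x"] by (simp add: algebra_simps)
    also have "\<dots> \<le> q * (\<bar>x\<bar> + \<bar>y\<bar>) powr (q - 1) * (y - x)"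
      using q that by (intro mult_mono powr_mono2) auto
    finally have "(max 0 y powr q - max 0 x powr q) * (y - x) \<le> q * (\<bar>x\<bar> + \<bar>y\<bar>) powr (q - 1) * (y - x) * (y - x)"
      using that by (intro mult_right_mono) auto
    then show ?thesis by (simp add: power2_eq_square mult.assoc)
  qed
  show ?thesis
  proof (cases "x \<le> y")
    case True
    then show ?thesis by (rule *)
  next
    case False
    then have "(max 0 x powr q - max 0 y powr q) * (x - y) \<le> q * (\<bar>y\<bar> + \<bar>x\<bar>) powr (q - 1) * (x - y)\<^sup>2"
      by (intro *) simp
    then show ?thesis by (simp add: algebra_simps power2_commute)
  qed
qed

text \<open>
  By the tangent inequality at \<open>y\<close>, the first-order remainder at \<open>x\<close> is at most the increment of the derivative
  times \<open>y - x\<close>.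
\<close>

lemma pos_part_powr_remainder_le:
  fixes x y :: real
  assumes p: "2 < p"
  shows "max 0 y powr p / p - max 0 x powr p / p - max 0 x powr (p - 1) * (y - x)
    \<le> (p - 1) * (\<bar>x\<bar> + \<bar>y\<bar>) powr (p - 2) * (y - x)\<^sup>2"
  using pos_part_powr_tangent_le[of p y x] pos_part_powr_Lipschitz[of "p - 1" y x] p
  by (simp add: algebra_simps)

section \<open>Bounded functionals\<close>

lemma Hdot_dual_add:
  assumes "f \<in> Hdot_dual s" "u \<in> Hdot s" "v \<in> Hdot s"
  shows "f (\<lambda>x. u x + v x) = f u + f v"
proof -
  have "\<forall>u\<in>Hdot s. \<forall>v\<in>Hdot s. f (\<lambda>x. u x + v x) = f u + f v"
    using assms(1) by (simp add: Hdot_dual_def)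
  then show ?thesis using assms(2,3) by (elim ballE) auto
qed

lemma Hdot_dual_scale:
  assumes "f \<in> Hdot_dual s" "u \<in> Hdot s"
  shows "f (\<lambda>x. c * u x) = c * f u"
proof -
  have "\<forall>u\<in>Hdot s. f (\<lambda>x. c * u x) = c * f u"
    using assms(1) by (simp add: Hdot_dual_def)
  then show ?thesis using assms(2) by (elim ballE) auto
qed

lemma Hdot_dual_diff:
  assumes f: "f \<in> Hdot_dual s" and u: "u \<in> Hdot s" and v: "v \<in> Hdot s"
  shows "f (\<lambda>x. u x - v x) = f u - f v"
  using Hdot_dual_add[OF f u Hdot_scale[OF v, of "-1"]] Hdot_dual_scale[OF f v, of "-1"] by simp

lemma Hdot_dual_bounded:
  assumes "f \<in> Hdot_dual s"
  obtains c where "0 \<le> c" "\<And>u. u \<in> Hdot s \<Longrightarrow> \<bar>f u\<bar> \<le> c * Hdot_norm s u"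
proof -
  obtain c where c: "\<forall>u\<in>Hdot s. \<bar>f u\<bar> \<le> c * Hdot_norm s u"
    using assms by (auto simp: Hdot_dual_def)
  have "\<bar>f u\<bar> \<le> \<bar>c\<bar> * Hdot_norm s u" if "u \<in> Hdot s" for u
    using c that mult_right_mono[OF abs_ge_self Hdot_norm_nonneg, of c s u] by force
  then show ?thesis using that[of "\<bar>c\<bar>"] by simp
qed

text \<open>
  The case of norm zero needs the boundedness of \<open>f\<close>, since such an element cannot be normalised.
\<close>

lemma Hdot_dual_norm_bound:
  assumes f: "f \<in> Hdot_dual s" and u: "u \<in> Hdot s"
  shows "\<bar>f u\<bar> \<le> Hdot_dual_norm s f * Hdot_norm s u"
proof -
  obtain c where c: "0 \<le> c" "\<And>u. u \<in> Hdot s \<Longrightarrow> \<bar>f u\<bar> \<le> c * Hdot_norm s u"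
    using Hdot_dual_bounded[OF f] by blast
  show ?thesis
  proof (cases "Hdot_norm s u = 0")
    case True
    then show ?thesis using c(2)[OF u] by simp
  next
    case False
    then have n: "Hdot_norm s u > 0" using Hdot_norm_nonneg[of s u] by simp
    let ?v = "\<lambda>x. inverse (Hdot_norm s u) * u x"
    have "bdd_above ((\<lambda>u. \<bar>f u\<bar>) ` {u \<in> Hdot s. Hdot_norm s u \<le> 1})"
      using c by (intro bdd_aboveI[of _ c]) (auto intro: order_trans mult_left_le)
    moreover have "?v \<in> {u \<in> Hdot s. Hdot_norm s u \<le> 1}"
      using n Hdot_scale[OF u] by (simp add: Hdot_norm_scale)
    ultimately have "\<bar>f ?v\<bar> \<le> Hdot_dual_norm s f"
      unfolding Hdot_dual_norm_def by (rule cSUP_upper2) simp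
    then show ?thesis
      using n unfolding Hdot_dual_scale[OF f u] by (simp add: abs_mult field_simps)
  qed
qed

section \<open>The critical term and its second-order remainder\<close>

text \<open>
  The number \<open>C\<close> bounds the coefficient and \<open>S\<close> is a Sobolev constant; they are parameters, so that
  the smallness conditions can be stated explicitly.
\<close>

locale critical_problem =
  fixes s :: real and a :: "'a::euclidean_space \<Rightarrow> real" and C S p :: real
  assumes s: "0 < s" "2 * s < real DIM('a)"
    and p_def: "p = crit_exp DIM('a) s"
    and a_measurable [measurable]: "a \<in> borel_measurable lebesgue"
    and a_bounds: "AE x in lebesgue. 0 \<le> a x \<and> a x \<le> C"
    and C: "0 < C" and S: "0 < S"
    and Sobolev: "\<And>u :: 'a \<Rightarrow> real. u \<in> Hdot s \<Longrightarrow>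
      (LINT x|lebesgue. \<bar>u x\<bar> powr p) \<le> S * Hdot_norm s u powr p"
begin

lemma p2: "2 < p" using crit_exp_gt_2[OF s] by (simp add: p_def)

lemmas HdotD' = HdotD[where 'a = 'a and s = s, folded p_def]

text \<open>
  The positive part is built into the critical term. It agrees with the original one on
  nonnegative functions and vanishes when the equation is tested with the negative part of its solution.
  The map \<open>nonlin_deriv u\<close> is the derivative of \<open>nonlin / p\<close> at \<open>u\<close>.
\<close>

definition nonlin :: "('a \<Rightarrow> real) \<Rightarrow> real" where
  "nonlin u = (LINT x|lebesgue. a x * max 0 (u x) powr p)"

definition nonlin_deriv :: "('a \<Rightarrow> real) \<Rightarrow> ('a \<Rightarrow> real) \<Rightarrow> real" where
  "nonlin_deriv u \<phi> = (LINT x|lebesgue. a x * max 0 (u x) powr (p - 1) * \<phi> x)"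

definition trunc_energy :: "(('a \<Rightarrow> real) \<Rightarrow> real) \<Rightarrow> ('a \<Rightarrow> real) \<Rightarrow> real" where
  "trunc_energy f u = 1 / 2 * (Hdot_norm s u)\<^sup>2 - nonlin u / p - f u"

lemma weighted_bound:
  assumes [measurable]: "g \<in> borel_measurable lebesgue" "h \<in> borel_measurable lebesgue"
    and h: "integrable lebesgue h" and le: "\<And>x. \<bar>g x\<bar> \<le> h x"
  shows "integrable lebesgue (\<lambda>x. a x * g x)"
    and "\<bar>LINT x|lebesgue. a x * g x\<bar> \<le> C * integral\<^sup>L lebesgue h"
proof -
  have ae: "AE x in lebesgue. norm (a x * g x) \<le> C * h x"
    using a_bounds
  proof eventually_elim
    case (elim x)
    have "\<bar>a x\<bar> * \<bar>g x\<bar> \<le> C * h x" using elim le[of x] C by (intro mult_mono) auto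
    then show ?case by (simp add: abs_mult)
  qed
  show int: "integrable lebesgue (\<lambda>x. a x * g x)"
  proof (rule Bochner_Integration.integrable_bound)
    show "integrable lebesgue (\<lambda>x. C * h x)" using h by simp
    show "AE x in lebesgue. norm (a x * g x) \<le> norm (C * h x)"
      using ae by eventually_elim auto
  qed measurable
  have "\<bar>LINT x|lebesgue. a x * g x\<bar> \<le> (LINT x|lebesgue. norm (a x * g x))"
    using integral_norm_bound[of lebesgue "\<lambda>x. a x * g x"] by simp
  also have "\<dots> \<le> (LINT x|lebesgue. C * h x)"
    using int h ae by (intro integral_mono_AE) auto
  finally show "\<bar>LINT x|lebesgue. a x * g x\<bar> \<le> C * integral\<^sup>L lebesgue h" by simp
qed

lemma nonlin_integrable:
  assumes u: "u \<in> Hdot s"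
  shows "integrable lebesgue (\<lambda>x. a x * max 0 (u x) powr p)"
    and "nonlin u \<le> C * S * Hdot_norm s u powr p" and "0 \<le> nonlin u"
proof -
  note [measurable] = HdotD'(1)[OF u]
  have "\<bar>max 0 (u x) powr p\<bar> \<le> \<bar>u x\<bar> powr p" for x using p2 by (auto intro!: powr_mono2)
  note * = weighted_bound[OF _ _ HdotD'(2)[OF u] this]
  show "integrable lebesgue (\<lambda>x. a x * max 0 (u x) powr p)" by (rule *) measurable
  have "\<bar>nonlin u\<bar> \<le> C * (LINT x|lebesgue. \<bar>u x\<bar> powr p)" unfolding nonlin_def by (rule *) measurable
  also have "\<dots> \<le> C * (S * Hdot_norm s u powr p)" using Sobolev[OF u] C by simp
  finally show "nonlin u \<le> C * S * Hdot_norm s u powr p" by simp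
  show "0 \<le> nonlin u" unfolding nonlin_def
    using a_bounds by (intro integral_nonneg_AE) (auto elim!: eventually_mono)
qed

lemma nonlin_deriv_integrable:
  assumes u: "u \<in> Hdot s" and \<phi>: "\<phi> \<in> Hdot s"
  shows "integrable lebesgue (\<lambda>x. a x * max 0 (u x) powr (p - 1) * \<phi> x)"
    and "\<exists>remainder_const\<ge>0. \<forall>\<phi>\<in>Hdot s. \<bar>nonlin_deriv u \<phi>\<bar> \<le> remainder_const * Hdot_norm s \<phi>"
proof -
  note [measurable] = HdotD'(1)[OF u]
  define A where "A = (LINT x|lebesgue. \<bar>u x\<bar> powr p)"
  have *: "integrable lebesgue (\<lambda>x. a x * (max 0 (u x) powr (p - 1) * \<phi> x)) \<and>
      \<bar>nonlin_deriv u \<phi>\<bar> \<le> (C * A powr ((p - 1) / p) * S powr (1 / p)) * Hdot_norm s \<phi>"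
    if \<phi>: "\<phi> \<in> Hdot s" for \<phi>
  proof -
    note [measurable] = HdotD'(1)[OF \<phi>]
    let ?h = "\<lambda>x. \<bar>u x\<bar> powr (p - 1) * \<bar>\<phi> x\<bar> powr 1"
    have hold: "integrable lebesgue ?h"
      "integral\<^sup>L lebesgue ?h \<le> A powr ((p - 1) / p) * (LINT x|lebesgue. \<bar>\<phi> x\<bar> powr p) powr (1 / p)"
      unfolding A_def
      by (rule Hoelder_powr; use HdotD'(2)[OF u] HdotD'(2)[OF \<phi>] p2 in simp)+
    have "\<bar>max 0 (u x) powr (p - 1) * \<phi> x\<bar> \<le> ?h x" for x
      using p2 by (auto simp: abs_mult intro!: mult_right_mono powr_mono2)
    note w = weighted_bound[OF _ _ hold(1) this]
    have "\<bar>nonlin_deriv u \<phi>\<bar> = \<bar>LINT x|lebesgue. a x * (max 0 (u x) powr (p - 1) * \<phi> x)\<bar>"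
      by (simp add: nonlin_deriv_def mult.assoc)
    also have "\<dots> \<le> C * integral\<^sup>L lebesgue ?h" by (rule w) measurable
    also have "\<dots> \<le> C * (A powr ((p - 1) / p) * (LINT x|lebesgue. \<bar>\<phi> x\<bar> powr p) powr (1 / p))"
      using C hold(2) by (intro mult_left_mono) auto
    also have "\<dots> \<le> C * (A powr ((p - 1) / p) * (S * Hdot_norm s \<phi> powr p) powr (1 / p))"
      using C Sobolev[OF \<phi>] p2
      by (intro mult_left_mono powr_mono2) (auto intro!: Bochner_Integration.integral_nonneg)
    also have "\<dots> = (C * A powr ((p - 1) / p) * S powr (1 / p)) * Hdot_norm s \<phi>"
      using S p2 Hdot_norm_nonneg[of s \<phi>] by (simp add: powr_mult powr_powr)
    finally have "\<bar>nonlin_deriv u \<phi>\<bar> \<le> (C * A powr ((p - 1) / p) * S powr (1 / p)) * Hdot_norm s \<phi>" .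
    moreover have "integrable lebesgue (\<lambda>x. a x * (max 0 (u x) powr (p - 1) * \<phi> x))"
      by (rule w) measurable
    ultimately show ?thesis by blast
  qed
  show "integrable lebesgue (\<lambda>x. a x * max 0 (u x) powr (p - 1) * \<phi> x)"
    using *[OF \<phi>] by (simp add: mult.assoc)
  have "0 \<le> C * A powr ((p - 1) / p) * S powr (1 / p)" using C by simp
  then show "\<exists>remainder_const\<ge>0. \<forall>\<phi>\<in>Hdot s. \<bar>nonlin_deriv u \<phi>\<bar> \<le> remainder_const * Hdot_norm s \<phi>" using * by blast
qed

lemma nonlin_deriv_scale: "nonlin_deriv u (\<lambda>x. c * \<phi> x) = c * nonlin_deriv u \<phi>"
proof -
  have "nonlin_deriv u (\<lambda>x. c * \<phi> x) = (LINT x|lebesgue. c * (a x * max 0 (u x) powr (p - 1) * \<phi> x))"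
    unfolding nonlin_deriv_def by (intro Bochner_Integration.integral_cong) auto
  then show ?thesis by (simp add: nonlin_deriv_def)
qed

lemma nonlin_convex:
  assumes u: "u \<in> Hdot s" and v: "v \<in> Hdot s"
  shows "nonlin u / p + nonlin_deriv u (\<lambda>x. v x - u x) \<le> nonlin v / p"
proof -
  note int = nonlin_integrable(1)[OF u] nonlin_integrable(1)[OF v] nonlin_deriv_integrable(1)[OF u Hdot_diff[OF v u s]]
  have "nonlin u / p + nonlin_deriv u (\<lambda>x. v x - u x) =
      (LINT x|lebesgue. a x * max 0 (u x) powr p / p + a x * max 0 (u x) powr (p - 1) * (v x - u x))"
    unfolding nonlin_def nonlin_deriv_def using int by simp
  also have "\<dots> \<le> (LINT x|lebesgue. a x * max 0 (v x) powr p / p)"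
  proof (rule integral_mono_AE)
    show "AE x in lebesgue. a x * max 0 (u x) powr p / p + a x * max 0 (u x) powr (p - 1) * (v x - u x)
        \<le> a x * max 0 (v x) powr p / p"
      using a_bounds
    proof eventually_elim
      case (elim x)
      then have "a x * (max 0 (u x) powr p / p + max 0 (u x) powr (p - 1) * (v x - u x))
          \<le> a x * (max 0 (v x) powr p / p)"
        using p2 by (intro mult_left_mono pos_part_powr_tangent_le) auto
      then show ?case by (simp add: algebra_simps)
    qed
  qed (use int in simp_all)
  finally show ?thesis by (simp add: nonlin_def)
qed

definition remainder_const where "remainder_const = (p - 1) * C * (2 powr (p + 1)) * S"

lemma remainder_const_pos: "0 < remainder_const" using p2 C S by (simp add: remainder_const_def)

text \<open>
  Hoelder's inequality with exponents \<open>(p - 2, 2)\<close> and the Sobolev inequality bound the second-order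
  remainder of the critical term on the ball of radius \<open>R\<close>. The positive power \<open>p - 2\<close> of \<open>R\<close> makes
  the constant small.
\<close>

lemma nonlin_remainder:
  assumes u: "u \<in> Hdot s" "Hdot_norm s u \<le> R" and v: "v \<in> Hdot s" "Hdot_norm s v \<le> R" and R: "0 < R"
  shows "nonlin v / p - nonlin u / p - nonlin_deriv u (\<lambda>x. v x - u x) \<le> remainder_const * R powr (p - 2) * (Hdot_norm s (\<lambda>x. v x - u x))\<^sup>2"
proof -
  note d = Hdot_diff[OF v(1) u(1) s]
  note [measurable] = HdotD'(1)[OF u(1)] HdotD'(1)[OF v(1)]
  note int = nonlin_integrable(1)[OF u(1)] nonlin_integrable(1)[OF v(1)] nonlin_deriv_integrable(1)[OF u(1) d]
  define b where "b x = \<bar>u x\<bar> + \<bar>v x\<bar>" for x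
  have [measurable]: "b \<in> borel_measurable lebesgue" unfolding b_def by measurable
  define n where "n = Hdot_norm s (\<lambda>x. v x - u x)"
  have n: "n \<ge> 0" by (simp add: n_def Hdot_norm_nonneg)
  have b: "\<bar>b x\<bar> powr p \<le> 2 powr p * (\<bar>u x\<bar> powr p + \<bar>v x\<bar> powr p)" for x
    using powr_add_le[of p "\<bar>u x\<bar>" "\<bar>v x\<bar>"] p2 by (simp add: b_def)
  have bint: "integrable lebesgue (\<lambda>x. \<bar>b x\<bar> powr p)"
    by (rule Bochner_Integration.integrable_bound[of _ "\<lambda>x. 2 powr p * (\<bar>u x\<bar> powr p + \<bar>v x\<bar> powr p)"])
      (use HdotD'(2)[OF u(1)] HdotD'(2)[OF v(1)] b in auto)
  have bound: "(LINT x|lebesgue. \<bar>w x\<bar> powr p) \<le> S * R powr p" if "w \<in> Hdot s" "Hdot_norm s w \<le> R" for w :: "'a \<Rightarrow> real"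
    using Sobolev[OF that(1)] that(2) S p2 Hdot_norm_nonneg[of s w]
    by (elim order_trans) (intro mult_left_mono powr_mono2; simp)
  have "(LINT x|lebesgue. \<bar>b x\<bar> powr p) \<le> (LINT x|lebesgue. 2 powr p * (\<bar>u x\<bar> powr p + \<bar>v x\<bar> powr p))"
    using bint b HdotD'(2)[OF u(1)] HdotD'(2)[OF v(1)] by (intro integral_mono) auto
  also have "\<dots> = 2 powr p * ((LINT x|lebesgue. \<bar>u x\<bar> powr p) + (LINT x|lebesgue. \<bar>v x\<bar> powr p))"
    using HdotD'(2)[OF u(1)] HdotD'(2)[OF v(1)] by simp
  also have "\<dots> \<le> 2 powr p * (S * R powr p + S * R powr p)"
    by (intro mult_left_mono add_mono bound u v) auto
  also have "\<dots> = 2 powr (p + 1) * S * R powr p" by (simp add: powr_add)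
  finally have bb: "(LINT x|lebesgue. \<bar>b x\<bar> powr p) \<le> 2 powr (p + 1) * S * R powr p" .
  let ?h = "\<lambda>x. (p - 1) * (\<bar>b x\<bar> powr (p - 2) * \<bar>v x - u x\<bar> powr 2)"
  have hold: "integrable lebesgue (\<lambda>x. \<bar>b x\<bar> powr (p - 2) * \<bar>v x - u x\<bar> powr 2)"
    "(LINT x|lebesgue. \<bar>b x\<bar> powr (p - 2) * \<bar>v x - u x\<bar> powr 2) \<le>
      (LINT x|lebesgue. \<bar>b x\<bar> powr p) powr ((p - 2) / p) * (LINT x|lebesgue. \<bar>v x - u x\<bar> powr p) powr (2 / p)"
    by (rule Hoelder_powr; use HdotD'(2)[OF d] bint p2 in simp)+
  have "nonlin v / p - nonlin u / p - nonlin_deriv u (\<lambda>x. v x - u x) =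
      (LINT x|lebesgue. a x * (max 0 (v x) powr p / p - max 0 (u x) powr p / p - max 0 (u x) powr (p - 1) * (v x - u x)))"
    unfolding nonlin_def nonlin_deriv_def using int by (simp add: right_diff_distrib mult.assoc)
  also have "\<dots> \<le> C * integral\<^sup>L lebesgue ?h"
  proof (rule order_trans[OF abs_ge_self weighted_bound(2)])
    fix x
    have "0 \<le> max 0 (v x) powr p / p - max 0 (u x) powr p / p - max 0 (u x) powr (p - 1) * (v x - u x)"
      using pos_part_powr_tangent_le[of p "u x" "v x"] p2 by simp
    then show "\<bar>max 0 (v x) powr p / p - max 0 (u x) powr p / p - max 0 (u x) powr (p - 1) * (v x - u x)\<bar> \<le> ?h x"
      using pos_part_powr_remainder_le[OF p2, of "v x" "u x"] by (simp add: b_def mult.assoc)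
  qed (use hold in \<open>simp_all\<close>)
  also have "\<dots> = (p - 1) * C * (LINT x|lebesgue. \<bar>b x\<bar> powr (p - 2) * \<bar>v x - u x\<bar> powr 2)"
    by simp
  also have "\<dots> \<le> (p - 1) * C * ((2 powr (p + 1) * S * R powr p) powr ((p - 2) / p) * (S * n powr p) powr (2 / p))"
    using p2 C hold(2) bb Sobolev[OF d] unfolding n_def
    by (intro mult_left_mono order_trans[OF hold(2)] mult_mono powr_mono2)
      (auto intro!: Bochner_Integration.integral_nonneg)
  also have "\<dots> = (p - 1) * C * ((2 powr (p + 1)) powr ((p - 2) / p) * (S powr ((p - 2) / p) * S powr (2 / p)) * R powr (p - 2) * n\<^sup>2)"
    using p2 S R n by (simp add: powr_mult powr_powr)
  also have "S powr ((p - 2) / p) * S powr (2 / p) = S"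
    using S p2 by (simp add: diff_divide_distrib flip: powr_add)
  also have "(p - 1) * C * ((2 powr (p + 1)) powr ((p - 2) / p) * S * R powr (p - 2) * n\<^sup>2)
      \<le> (p - 1) * C * ((2 powr (p + 1)) * S * R powr (p - 2) * n\<^sup>2)"
  proof -
    have "(2 powr (p + 1)) powr ((p - 2) / p) \<le> (2 powr (p + 1)) powr 1"
      using p2 by (intro powr_mono ge_one_powr_ge_zero) auto
    then show ?thesis using p2 C S by (intro mult_left_mono mult_right_mono) auto
  qed
  finally show ?thesis by (simp add: n_def remainder_const_def mult_ac)
qed

end

section \<open>Minimisation on a small ball\<close>

text \<open>
  First-order optimality: \<open>t \<cdot> \<delta>\<close> dominates \<open>t\<^sup>2 \<cdot> q\<close> for small \<open>t\<close> of the sign opposite to \<open>\<delta>\<close>.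
\<close>

lemma linear_coefficient_zero:
  fixes \<delta> q t0 :: real
  assumes t0: "0 < t0" and le: "\<And>t. \<bar>t\<bar> \<le> t0 \<Longrightarrow> 0 \<le> t * \<delta> + t\<^sup>2 * q"
  shows "\<delta> = 0"
proof (rule ccontr)
  assume \<delta>: "\<delta> \<noteq> 0"
  \<comment> \<open>At \<open>t = - \<eta> \<delta>\<close> the expression is \<open>\<eta> \<delta>\<^sup>2 (\<eta> q - 1)\<close>; the two bounds on \<open>\<eta>\<close> make \<open>t\<close> admissible and the bracket negative.\<close>
  define \<eta> where "\<eta> = min (t0 / \<bar>\<delta>\<bar>) (1 / (2 * (\<bar>q\<bar> + 1)))"
  have \<eta>: "0 < \<eta>" "\<eta> * \<bar>\<delta>\<bar> \<le> t0" "\<eta> * (2 * (\<bar>q\<bar> + 1)) \<le> 1"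
    using \<delta> t0 by (auto simp: \<eta>_def min_def field_simps)
  have "\<eta> * q \<le> \<eta> * \<bar>q\<bar>" using \<eta>(1) by (intro mult_left_mono) auto
  moreover have "\<eta> * (2 * (\<bar>q\<bar> + 1)) = 2 * (\<eta> * \<bar>q\<bar>) + 2 * \<eta>" by (simp add: algebra_simps)
  ultimately have "\<eta> * q < 1" using \<eta>(1,3) by linarith
  then have "\<eta> * \<delta>\<^sup>2 * (\<eta> * q - 1) < 0" using \<eta>(1) \<delta> by (intro mult_pos_neg) auto
  moreover have "0 \<le> (- \<eta> * \<delta>) * \<delta> + (- \<eta> * \<delta>)\<^sup>2 * q"
    using \<eta> by (intro le) (simp add: abs_mult)
  ultimately show False by (simp add: power2_eq_square algebra_simps)
qed

context critical_problem
begin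

text \<open>
  Convexity of the critical term gives the exact first variation from above, with a quadratic error
  only. This one-sided estimate suffices at a minimum, because \<open>t\<close> may have either sign.
\<close>

lemma trunc_energy_add_le:
  assumes f: "f \<in> Hdot_dual s" and u: "u \<in> Hdot s" and \<phi>: "\<phi> \<in> Hdot s"
  shows "trunc_energy f (\<lambda>x. u x + t * \<phi> x) \<le>
    trunc_energy f u + t * (gagliardo_form s u \<phi> - nonlin_deriv u \<phi> - f \<phi>) + t\<^sup>2 * (gagliardo_form s \<phi> \<phi> / 2)"
proof -
  note tp = Hdot_scale[OF \<phi>, of t]
  have "nonlin u / p + t * nonlin_deriv u \<phi> \<le> nonlin (\<lambda>x. u x + t * \<phi> x) / p"
    using nonlin_convex[OF u Hdot_add[OF u tp s]] nonlin_deriv_scale[of u t \<phi>] by simp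
  then show ?thesis
    using form_sq_add_scaled[OF u \<phi> s, of t] Hdot_dual_add[OF f u tp] Hdot_dual_scale[OF f \<phi>, of t]
    by (simp add: trunc_energy_def Hdot_norm_sq algebra_simps)
qed

text \<open>
  The square of the norm contributes \<open>1/8\<close> of the squared distance; the remainder of the critical
  term at the midpoint takes away at most \<open>1/16\<close> of it.
\<close>

lemma trunc_energy_midpoint_convex:
  assumes f: "f \<in> Hdot_dual s" and u: "u \<in> Hdot s" "Hdot_norm s u \<le> R" and v: "v \<in> Hdot s" "Hdot_norm s v \<le> R"
    and R: "0 < R" "remainder_const * R powr (p - 2) \<le> 1 / 4"
  defines "z \<equiv> \<lambda>x. 1 / 2 * u x + 1 / 2 * v x"
  shows "z \<in> Hdot s" "Hdot_norm s z \<le> R"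
    "trunc_energy f z + 1 / 16 * (Hdot_norm s (\<lambda>x. u x - v x))\<^sup>2 \<le> (trunc_energy f u + trunc_energy f v) / 2"
proof -
  note hu = Hdot_scale[OF u(1), of "1 / 2"] and hv = Hdot_scale[OF v(1), of "1 / 2"]
  show z: "z \<in> Hdot s" unfolding z_def by (rule Hdot_add[OF hu hv s])
  have "Hdot_norm s z \<le> \<bar>1 / 2\<bar> * Hdot_norm s u + \<bar>1 / 2\<bar> * Hdot_norm s v"
    unfolding z_def using Hdot_norm_triangle[OF hu hv s] by (simp only: Hdot_norm_scale)
  then show nz: "Hdot_norm s z \<le> R" using u v by simp
  define d where "d x = u x - v x" for x
  have d: "d \<in> Hdot s" unfolding d_def by (rule Hdot_diff[OF u(1) v(1) s])
  have uz: "u = (\<lambda>x. z x + 1 / 2 * d x)" and vz: "v = (\<lambda>x. z x + (- 1 / 2) * d x)"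
    by (auto simp: z_def d_def fun_eq_iff field_simps)
  have du: "(\<lambda>x. u x - z x) = (\<lambda>x. 1 / 2 * d x)" and dv: "(\<lambda>x. v x - z x) = (\<lambda>x. (- 1 / 2) * d x)"
    by (auto simp: z_def d_def fun_eq_iff field_simps)
  let ?n = "(Hdot_norm s d)\<^sup>2"
  have half: "(Hdot_norm s (\<lambda>x. 1 / 2 * d x))\<^sup>2 = ?n / 4" "(Hdot_norm s (\<lambda>x. (- 1 / 2) * d x))\<^sup>2 = ?n / 4"
    unfolding Hdot_norm_scale by (simp_all add: power_mult_distrib power_divide)
  have le: "remainder_const * R powr (p - 2) * (?n / 4) \<le> 1 / 4 * (?n / 4)"
    using R by (intro mult_right_mono) auto
  have "nonlin u / p - nonlin z / p - nonlin_deriv z (\<lambda>x. 1 / 2 * d x) \<le> remainder_const * R powr (p - 2) * (?n / 4)"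
    using nonlin_remainder[OF z nz u R(1)] unfolding du half .
  then have 1: "nonlin u / p \<le> nonlin z / p + 1 / 2 * nonlin_deriv z d + ?n / 16"
    using le unfolding nonlin_deriv_scale[of z "1 / 2" d] by linarith
  have "nonlin v / p - nonlin z / p - nonlin_deriv z (\<lambda>x. (- 1 / 2) * d x) \<le> remainder_const * R powr (p - 2) * (?n / 4)"
    using nonlin_remainder[OF z nz v R(1)] unfolding dv half .
  then have 2: "nonlin v / p \<le> nonlin z / p - 1 / 2 * nonlin_deriv z d + ?n / 16"
    using le unfolding nonlin_deriv_scale[of z "- 1 / 2" d] by linarith
  have 3: "(Hdot_norm s u)\<^sup>2 = (Hdot_norm s z)\<^sup>2 + gagliardo_form s z d + ?n / 4"
    using form_sq_add_scaled[OF z d s, of "1 / 2"] by (subst uz) (simp add: Hdot_norm_sq power_divide)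
  have 4: "(Hdot_norm s v)\<^sup>2 = (Hdot_norm s z)\<^sup>2 - gagliardo_form s z d + ?n / 4"
    using form_sq_add_scaled[OF z d s, of "- 1 / 2"] by (subst vz) (simp add: Hdot_norm_sq power_divide)
  have 5: "f z = (f u + f v) / 2"
    unfolding z_def using Hdot_dual_add[OF f hu hv] Hdot_dual_scale[OF f u(1), of "1 / 2"]
      Hdot_dual_scale[OF f v(1), of "1 / 2"] by simp
  show "trunc_energy f z + 1 / 16 * (Hdot_norm s (\<lambda>x. u x - v x))\<^sup>2 \<le> (trunc_energy f u + trunc_energy f v) / 2"
    using 1 2 3 4 5 unfolding trunc_energy_def d_def[symmetric] by argo
qed

text \<open>
  Lower semicontinuity along sequences converging in norm, in a quantitative form.
\<close>

lemma trunc_energy_lower_bound: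
  assumes f: "f \<in> Hdot_dual s" and u: "u \<in> Hdot s" "Hdot_norm s u \<le> R" and R: "0 < R" "remainder_const * R powr (p - 2) \<le> 1 / 4"
  shows "\<exists>c. \<forall>v\<in>Hdot s. Hdot_norm s v \<le> R \<longrightarrow>
    trunc_energy f u - c * Hdot_norm s (\<lambda>x. v x - u x) - 1 / 4 * (Hdot_norm s (\<lambda>x. v x - u x))\<^sup>2 \<le> trunc_energy f v"
proof -
  obtain cf where cf: "0 \<le> cf" "\<And>u. u \<in> Hdot s \<Longrightarrow> \<bar>f u\<bar> \<le> cf * Hdot_norm s u"
    using Hdot_dual_bounded[OF f] by blast
  obtain cG where cG: "\<forall>\<phi>\<in>Hdot s. \<bar>nonlin_deriv u \<phi>\<bar> \<le> cG * Hdot_norm s \<phi>"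
    using nonlin_deriv_integrable(2)[OF u(1) u(1)] by blast
  have "trunc_energy f u - (R + cG + cf) * Hdot_norm s (\<lambda>x. v x - u x) - 1 / 4 * (Hdot_norm s (\<lambda>x. v x - u x))\<^sup>2 \<le> trunc_energy f v"
    if v: "v \<in> Hdot s" "Hdot_norm s v \<le> R" for v
  proof -
    define d where "d x = v x - u x" for x
    have d: "d \<in> Hdot s" unfolding d_def by (rule Hdot_diff[OF v(1) u(1) s])
    have vd: "v = (\<lambda>x. u x + 1 * d x)" by (simp add: d_def)
    let ?n = "Hdot_norm s d"
    have "nonlin v / p - nonlin u / p - nonlin_deriv u d \<le> remainder_const * R powr (p - 2) * ?n\<^sup>2"
      using nonlin_remainder[OF u v R(1)] by (simp add: d_def[abs_def])
    also have "\<dots> \<le> 1 / 4 * ?n\<^sup>2" using R by (intro mult_right_mono) auto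
    finally have 1: "nonlin v / p - nonlin u / p - nonlin_deriv u d \<le> 1 / 4 * ?n\<^sup>2" .
    have 2: "\<bar>nonlin_deriv u d\<bar> \<le> cG * ?n" "\<bar>f d\<bar> \<le> cf * ?n" using cG cf d by auto
    have "(Hdot_norm s v)\<^sup>2 = (Hdot_norm s u)\<^sup>2 + 2 * gagliardo_form s u d + ?n\<^sup>2"
      using form_sq_add_scaled[OF u(1) d s, of 1] by (subst vd) (simp add: Hdot_norm_sq)
    moreover have "\<bar>gagliardo_form s u d\<bar> \<le> R * ?n"
      using form_cauchy_schwarz[OF u(1) d s] mult_right_mono[OF u(2) Hdot_norm_nonneg[of s d]] by linarith
    ultimately have 3: "(Hdot_norm s u)\<^sup>2 / 2 - R * ?n \<le> (Hdot_norm s v)\<^sup>2 / 2"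
      by (smt (verit) zero_le_power2 field_sum_of_halves)
    have "f d = f v - f u" unfolding d_def by (rule Hdot_dual_diff[OF f v(1) u(1)])
    then show ?thesis
      using 1 2 3 unfolding trunc_energy_def d_def[symmetric, abs_def] d_def[symmetric]
      by (simp add: algebra_simps)
  qed
  then show ?thesis by blast
qed

text \<open>
  For a minimising sequence the midpoint inequality bounds the squared distance of two members by the
  sum of their excesses over the infimum, so the sequence is a Cauchy sequence.
\<close>

lemma trunc_energy_minimizer:
  assumes f: "f \<in> Hdot_dual s" and R: "0 < R" "remainder_const * R powr (p - 2) \<le> 1 / 4"
  obtains u where "u \<in> Hdot s" "Hdot_norm s u \<le> R"
    "\<And>v. v \<in> Hdot s \<Longrightarrow> Hdot_norm s v \<le> R \<Longrightarrow> trunc_energy f u \<le> trunc_energy f v"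
proof -
  define B where "B = {u :: 'a \<Rightarrow> real. u \<in> Hdot s \<and> Hdot_norm s u \<le> R}"
  have zero: "(\<lambda>x. 0) \<in> B" using Hdot_zero Hdot_norm_scale[of s 0 "\<lambda>x :: 'a. 0"] R by (auto simp: B_def)
  have bdd: "bdd_below (trunc_energy f ` B)"
  proof -
    obtain cf where cf: "0 \<le> cf" "\<And>u. u \<in> Hdot s \<Longrightarrow> \<bar>f u\<bar> \<le> cf * Hdot_norm s u"
      using Hdot_dual_bounded[OF f] by blast
    have "- (C * S * R powr p) / p - cf * R \<le> trunc_energy f u" if "u \<in> B" for u
    proof -
      have u: "u \<in> Hdot s" "Hdot_norm s u \<le> R" using that by (auto simp: B_def)
      have "nonlin u \<le> C * S * R powr p"
        using nonlin_integrable(2)[OF u(1)] u(2) C S p2 Hdot_norm_nonneg[of s u]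
        by (elim order_trans) (intro mult_left_mono powr_mono2; simp)
      then have "nonlin u / p \<le> C * S * R powr p / p" using p2 by (intro divide_right_mono) auto
      moreover have "\<bar>f u\<bar> \<le> cf * R" using cf(2)[OF u(1)] mult_left_mono[OF u(2) cf(1)] by linarith
      ultimately show ?thesis unfolding trunc_energy_def using zero_le_power2[of "Hdot_norm s u"] by linarith
    qed
    then show ?thesis by (intro bdd_belowI2)
  qed
  define m where "m = (INF u\<in>B. trunc_energy f u)"
  have m: "m \<le> trunc_energy f u" if "u \<in> B" for u unfolding m_def using bdd that by (rule cINF_lower)
  have "\<exists>u\<in>B. trunc_energy f u < m + inverse (real (Suc n))" for n
    using cINF_less_iff[OF _ bdd, of "m + inverse (real (Suc n))"] zero by (auto simp: m_def)
  then obtain w where w: "\<And>n. w n \<in> B" "\<And>n. trunc_energy f (w n) < m + inverse (real (Suc n))" by metis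
  have wH: "w n \<in> Hdot s" "Hdot_norm s (w n) \<le> R" for n using w(1)[of n] by (auto simp: B_def)
  have gap: "(Hdot_norm s (\<lambda>x. w i x - w j x))\<^sup>2 \<le> 8 * (inverse (real (Suc i)) + inverse (real (Suc j)))" for i j
    using trunc_energy_midpoint_convex[OF f wH[of i] wH[of j] R] m[of "\<lambda>x. 1 / 2 * w i x + 1 / 2 * w j x"] w(2)[of i] w(2)[of j]
    by (simp add: B_def)
  obtain u where u: "u \<in> Hdot s" "(\<lambda>n. Hdot_norm s (\<lambda>x. w n x - u x)) \<longlonglongrightarrow> 0"
  proof (rule Hdot_complete[of s w])
    fix e :: real assume e: "0 < e"
    obtain M where M: "inverse (real (Suc M)) < e\<^sup>2 / 16" using reals_Archimedean[of "e\<^sup>2 / 16"] e by auto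
    have small: "inverse (real (Suc i)) < e\<^sup>2 / 16" if "i \<ge> M" for i
      using le_imp_inverse_le[of "real (Suc M)" "real (Suc i)"] that M by (smt (verit) Suc_le_mono of_nat_0_less_iff of_nat_mono zero_less_Suc)
    have "Hdot_norm s (\<lambda>x. w i x - w j x) < e" if "i \<ge> M" "j \<ge> M" for i j
      using gap[of i j] small[OF that(1)] small[OF that(2)] e by (intro power_less_imp_less_base[of _ 2 e]) auto
    then show "\<exists>M. \<forall>m\<ge>M. \<forall>n\<ge>M. Hdot_norm s (\<lambda>x. w m x - w n x) < e" by blast
  qed (use s wH in auto)
  have "Hdot_norm s u \<le> R + Hdot_norm s (\<lambda>x. w n x - u x)" for n
  proof -
    note d = Hdot_diff[OF wH(1)[of n] u(1) s]
    have "Hdot_norm s (\<lambda>x. w n x + (-1) * (w n x - u x)) \<le> Hdot_norm s (w n) + \<bar>-1\<bar> * Hdot_norm s (\<lambda>x. w n x - u x)"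
      using Hdot_norm_triangle[OF wH(1)[of n] Hdot_scale[OF d, of "-1"] s] by (simp only: Hdot_norm_scale)
    then show ?thesis using wH(2)[of n] by simp
  qed
  then have uR: "Hdot_norm s u \<le> R"
    using LIMSEQ_le_const[OF tendsto_add[OF tendsto_const[of R] u(2)]] by fastforce
  obtain c where c: "\<And>v. v \<in> Hdot s \<Longrightarrow> Hdot_norm s v \<le> R \<Longrightarrow>
    trunc_energy f u - c * Hdot_norm s (\<lambda>x. v x - u x) - 1 / 4 * (Hdot_norm s (\<lambda>x. v x - u x))\<^sup>2 \<le> trunc_energy f v"
    using trunc_energy_lower_bound[OF f u(1) uR R] by blast
  have "(\<lambda>n. trunc_energy f u - c * Hdot_norm s (\<lambda>x. w n x - u x) - 1 / 4 * (Hdot_norm s (\<lambda>x. w n x - u x))\<^sup>2)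
      \<longlonglongrightarrow> trunc_energy f u - c * 0 - 1 / 4 * 0\<^sup>2"
    by (intro tendsto_intros u(2))
  moreover have "(\<lambda>n. m + inverse (real (Suc n))) \<longlonglongrightarrow> m + 0"
    by (intro tendsto_intros LIMSEQ_inverse_real_of_nat)
  moreover have "trunc_energy f u - c * Hdot_norm s (\<lambda>x. w n x - u x) - 1 / 4 * (Hdot_norm s (\<lambda>x. w n x - u x))\<^sup>2
      \<le> m + inverse (real (Suc n))" for n
    using c[OF wH[of n]] w(2)[of n] by linarith
  ultimately have "trunc_energy f u \<le> m" by (auto dest: LIMSEQ_le)
  then show ?thesis using that[of u] u(1) uR m by (auto simp: B_def intro: order_trans)
qed

text \<open>
  Along the ray through \<open>\<phi>0\<close> the energy has the nonzero slope \<open>- f \<phi>0\<close> at the origin, so the minimum is negative.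
  On the sphere of radius \<open>R\<close> the critical term and \<open>f\<close> are each at most a quarter of \<open>R\<^sup>2\<close>, so the energy is
  nonnegative there and the minimiser is an interior point.
\<close>

lemma local_minimizer_solves:
  assumes f: "f \<in> Hdot_dual s" and nz: "\<phi>0 \<in> Hdot s" "f \<phi>0 \<noteq> 0"
    and R: "0 < R" "remainder_const * R powr (p - 2) \<le> 1 / 4" and d: "Hdot_dual_norm s f \<le> R / 4"
  obtains u where "u \<in> Hdot s" "trunc_energy f u < 0"
    "\<And>\<phi>. \<phi> \<in> Hdot s \<Longrightarrow> gagliardo_form s u \<phi> = nonlin_deriv u \<phi> + f \<phi>"
proof -
  obtain u where u: "u \<in> Hdot s" "Hdot_norm s u \<le> R"
    and min: "\<And>v. v \<in> Hdot s \<Longrightarrow> Hdot_norm s v \<le> R \<Longrightarrow> trunc_energy f u \<le> trunc_energy f v"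
    using trunc_energy_minimizer[OF f R] by blast
  have J0: "trunc_energy f (\<lambda>x. 0) = 0"
    using Hdot_norm_scale[of s 0 "\<lambda>x :: 'a. 0"] Hdot_dual_scale[OF f Hdot_zero, of 0]
    by (simp add: trunc_energy_def nonlin_def)
  have neg: "trunc_energy f u < 0"
  proof (rule ccontr)
    assume "\<not> trunc_energy f u < 0"
    then have ge: "trunc_energy f v \<ge> 0" if "v \<in> Hdot s" "Hdot_norm s v \<le> R" for v
      using min[OF that] by simp
    have "- f \<phi>0 = 0"
    proof (rule linear_coefficient_zero[of "R / (Hdot_norm s \<phi>0 + 1)" _ "gagliardo_form s \<phi>0 \<phi>0 / 2"])
      show "0 < R / (Hdot_norm s \<phi>0 + 1)"
        using R Hdot_norm_nonneg[of s \<phi>0] by (simp add: add_nonneg_pos)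
      fix t assume "\<bar>t\<bar> \<le> R / (Hdot_norm s \<phi>0 + 1)"
      then have "\<bar>t\<bar> * Hdot_norm s \<phi>0 + \<bar>t\<bar> \<le> R"
        using Hdot_norm_nonneg[of s \<phi>0] by (simp add: pos_le_divide_eq add_nonneg_pos algebra_simps)
      then have "Hdot_norm s (\<lambda>x. t * \<phi>0 x) \<le> R"
        unfolding Hdot_norm_scale by linarith
      then have "0 \<le> trunc_energy f (\<lambda>x. t * \<phi>0 x)" by (intro ge Hdot_scale nz)
      also have "\<dots> \<le> 1 / 2 * (Hdot_norm s (\<lambda>x. t * \<phi>0 x))\<^sup>2 - f (\<lambda>x. t * \<phi>0 x)"
        using nonlin_integrable(3)[OF Hdot_scale[OF nz(1)], of t] p2 by (simp add: trunc_energy_def)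
      also have "\<dots> = t * - f \<phi>0 + t\<^sup>2 * (gagliardo_form s \<phi>0 \<phi>0 / 2)"
        by (simp add: Hdot_norm_scale Hdot_dual_scale[OF f nz(1)] power_mult_distrib Hdot_norm_sq)
      finally show "0 \<le> t * - f \<phi>0 + t\<^sup>2 * (gagliardo_form s \<phi>0 \<phi>0 / 2)" .
    qed
    then show False using nz by simp
  qed
  have inside: "Hdot_norm s u < R"
  proof (rule ccontr)
    assume "\<not> Hdot_norm s u < R"
    then have n: "Hdot_norm s u = R" using u by simp
    have Rp: "R powr p = R powr (p - 2) * R\<^sup>2"
      using R(1) powr_add[of R "p - 2" 2] by simp
    have "C * S \<le> remainder_const"
    proof -
      have "1 * 1 \<le> (p - 1) * 2 powr (p + 1)"
        using p2 by (intro mult_mono ge_one_powr_ge_zero) auto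
      then have "1 * (C * S) \<le> ((p - 1) * 2 powr (p + 1)) * (C * S)"
        using C S by (intro mult_right_mono) auto
      then show ?thesis by (simp add: remainder_const_def mult_ac)
    qed
    then have "C * S * R powr (p - 2) \<le> remainder_const * R powr (p - 2)"
      by (intro mult_right_mono) auto
    then have "C * S * R powr (p - 2) \<le> 1 / 4" using R(2) by linarith
    then have "C * S * R powr (p - 2) * R\<^sup>2 \<le> 1 / 4 * R\<^sup>2"
      by (rule mult_right_mono) simp
    then have "nonlin u \<le> 1 / 4 * R\<^sup>2"
      using nonlin_integrable(2)[OF u(1)] unfolding n Rp by (simp add: mult.assoc)
    moreover have "nonlin u / p \<le> nonlin u" using p2 nonlin_integrable(3)[OF u(1)] by (simp add: divide_le_eq mult_le_cancel_left1)
    moreover have "f u \<le> 1 / 4 * R\<^sup>2"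
      using Hdot_dual_norm_bound[OF f u(1)] mult_right_mono[OF d, of R] R(1)
      unfolding n power2_eq_square by linarith
    ultimately have "0 \<le> trunc_energy f u" unfolding trunc_energy_def n by linarith
    then show False using neg by simp
  qed
  have "gagliardo_form s u \<phi> = nonlin_deriv u \<phi> + f \<phi>" if \<phi>: "\<phi> \<in> Hdot s" for \<phi>
  proof -
    let ?t0 = "(R - Hdot_norm s u) / (Hdot_norm s \<phi> + 1)"
    have "gagliardo_form s u \<phi> - nonlin_deriv u \<phi> - f \<phi> = 0"
    proof (rule linear_coefficient_zero[of ?t0 _ "gagliardo_form s \<phi> \<phi> / 2"])
      show "0 < ?t0" using inside Hdot_norm_nonneg[of s \<phi>] by (simp add: add_nonneg_pos)
      fix t assume "\<bar>t\<bar> \<le> ?t0"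
      then have "\<bar>t\<bar> * Hdot_norm s \<phi> + \<bar>t\<bar> \<le> R - Hdot_norm s u"
        using Hdot_norm_nonneg[of s \<phi>] by (simp add: pos_le_divide_eq add_nonneg_pos algebra_simps)
      moreover have "Hdot_norm s (\<lambda>x. u x + t * \<phi> x) \<le> Hdot_norm s u + \<bar>t\<bar> * Hdot_norm s \<phi>"
        using Hdot_norm_triangle[OF u(1) Hdot_scale[OF \<phi>, of t] s] by (simp only: Hdot_norm_scale)
      ultimately have "Hdot_norm s (\<lambda>x. u x + t * \<phi> x) \<le> R" by linarith
      then have "trunc_energy f u \<le> trunc_energy f (\<lambda>x. u x + t * \<phi> x)"
        by (intro min Hdot_add[OF u(1) Hdot_scale[OF \<phi>] s])
      then show "0 \<le> t * (gagliardo_form s u \<phi> - nonlin_deriv u \<phi> - f \<phi>) + t\<^sup>2 * (gagliardo_form s \<phi> \<phi> / 2)"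
        using trunc_energy_add_le[OF f u(1) \<phi>, of t] by linarith
    qed
    then show ?thesis by simp
  qed
  then show ?thesis using that u(1) neg by blast
qed

end

section \<open>The strong maximum principle\<close>

lemma lebesgue_distr_translation:
  fixes h :: "'a::euclidean_space"
  shows "(+) h \<in> lebesgue \<rightarrow>\<^sub>M lebesgue" "distr lebesgue lebesgue ((+) h) = lebesgue"
proof -
  have T: "(\<lambda>x. h + (\<Sum>j\<in>Basis. (1 * (x \<bullet> j)) *\<^sub>R j)) = (+) h"
    by (simp add: euclidean_representation fun_eq_iff)
  show "(+) h \<in> lebesgue \<rightarrow>\<^sub>M lebesgue"
    using lebesgue_affine_measurable[of "\<lambda>_. 1" h] unfolding T by simp
  show "distr lebesgue lebesgue ((+) h) = lebesgue"
    using lebesgue_affine_euclidean[of "\<lambda>_. 1" h] unfolding T by (simp add: density_1)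
qed

text \<open>
  Translating both variables preserves the product measure and the kernel.
\<close>

lemma Hdot_translation:
  fixes u :: "'a::euclidean_space \<Rightarrow> real"
  assumes u: "u \<in> Hdot s"
  shows "(\<lambda>x. u (h + x)) \<in> Hdot s"
proof -
  note T [measurable] = lebesgue_distr_translation(1)[of h] and D = lebesgue_distr_translation(2)[of h]
  note [measurable] = HdotD(1)[OF u]
  have T2 [measurable]: "(\<lambda>(x, y). (h + x, h + y)) \<in> lebesgue2 \<rightarrow>\<^sub>M lebesgue2" by measurable
  have D2: "distr lebesgue2 lebesgue2 (\<lambda>(x, y). (h + x, h + y)) = lebesgue2"
    using pair_measure_distr[OF T T, unfolded D, OF sigma_finite_lebesgue] by simp
  have "integrable (distr lebesgue lebesgue ((+) h)) (\<lambda>x. \<bar>u x\<bar> powr crit_exp DIM('a) s)"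
    unfolding D by (rule HdotD[OF u])
  then have 1: "integrable lebesgue (\<lambda>x. \<bar>u (h + x)\<bar> powr crit_exp DIM('a) s)"
    by (subst (asm) integrable_distr_eq) auto
  have "integrable (distr lebesgue2 lebesgue2 (\<lambda>(x, y). (h + x, h + y))) (gagliardo_integrand s u u)"
    unfolding D2 by (rule HdotD[OF u])
  then have 2: "integrable lebesgue2 (\<lambda>z. gagliardo_integrand s u u ((\<lambda>(x, y). (h + x, h + y)) z))"
    by (subst (asm) integrable_distr_eq) auto
  have "(\<lambda>z. gagliardo_integrand s u u ((\<lambda>(x, y). (h + x, h + y)) z)) =
      gagliardo_integrand s (\<lambda>x. u (h + x)) (\<lambda>x. u (h + x))"
    by (auto simp: gagliardo_integrand_def fun_eq_iff)
  with 1 2 show ?thesis by (simp add: Hdot_def)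
qed

lemma truncated_zero_set_tendsto:
  fixes t :: real
  assumes "0 \<le> t"
  shows "(\<lambda>n. max 0 (1 - real (Suc n) * t)) \<longlonglongrightarrow> (if t = 0 then 1 else 0)"
proof (cases "t = 0")
  case False
  then have t: "t > 0" using assms by simp
  obtain M where M: "1 / t < real M" using reals_Archimedean2 by blast
  have "eventually (\<lambda>n. max 0 (1 - real (Suc n) * t) = 0) sequentially"
    using eventually_ge_at_top[of M]
  proof eventually_elim
    case (elim n)
    then have "1 / t < real (Suc n)" using M by linarith
    then show ?case using t by (simp add: field_simps)
  qed
  then show ?thesis using False by (simp add: tendsto_eventually)
qed simp

text \<open>
  With \<open>g\<^sub>n = (1 - n u)\<^sub>+\<close> the test functions \<open>\<psi> \<cdot> g\<^sub>n\<close> concentrate on the zero set of \<open>u\<close>. Splitting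
  \<open>\<psi> x g\<^sub>n x - \<psi> y g\<^sub>n y\<close> symmetrically, the part with the increment of \<open>g\<^sub>n\<close> has the good sign, since \<open>g\<^sub>n\<close> is a
  decreasing function of \<open>u\<close>, and the other part is bounded by \<open>B\<close>, the absolute value of the integrand for \<open>\<psi>\<close>. Reverse
  Fatou then applies to the integrands: their limit \<open>E\<close> has nonnegative integral, but \<open>E \<le> 0\<close>,
  and \<open>E\<close> is strictly negative where \<open>u x = 0\<close>, \<open>\<psi> x > 0\<close> and \<open>u y > 0\<close>.
\<close>

lemma nonlocal_supersolution_zero_set:
  fixes u :: "'a::euclidean_space \<Rightarrow> real"
  assumes s: "0 < s" "2 * s < real DIM('a)"
    and u: "u \<in> Hdot s" and u0: "\<And>x. 0 \<le> u x"
    and super: "\<And>\<phi>. \<phi> \<in> Hdot s \<Longrightarrow> (\<And>x. 0 \<le> \<phi> x) \<Longrightarrow> 0 \<le> gagliardo_form s u \<phi>"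
    and nz: "\<not> (AE x in lebesgue. u x = 0)"
    and \<psi>: "\<psi> \<in> Hdot s" "\<And>x. 0 \<le> \<psi> x" "\<And>x. \<psi> x \<le> 1"
  shows "AE x in lebesgue. u x = 0 \<longrightarrow> \<psi> x = 0"
proof -
  note [measurable] = HdotD(1)[OF u] HdotD(1)[OF \<psi>(1)]
  define g where "g n x = max 0 (1 - real (Suc n) * u x)" for n x
  define \<phi> where "\<phi> n x = \<psi> x * g n x" for n x
  define \<zeta> where "\<zeta> x = \<psi> x * (if u x = 0 then 1 else 0)" for x
  have g: "0 \<le> g n x" "g n x \<le> 1" for n x using u0[of x] by (auto simp: g_def)
  have g_anti: "(u x - u y) * (g n x - g n y) \<le> 0" for n x y
  proof (cases "u x \<le> u y")
    case True
    then have "real (Suc n) * u x \<le> real (Suc n) * u y" by (intro mult_left_mono) auto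
    then have "g n y \<le> g n x" unfolding g_def by (intro max.mono) linarith+
    then show ?thesis using True by (intro mult_nonpos_nonneg) linarith+
  next
    case False
    then have "real (Suc n) * u y \<le> real (Suc n) * u x" by (intro mult_left_mono) auto
    then have "g n x \<le> g n y" unfolding g_def by (intro max.mono) linarith+
    then show ?thesis using False by (intro mult_nonneg_nonpos) linarith+
  qed
  have \<phi>H: "\<phi> n \<in> Hdot s" for n
  proof (rule Hdot_dominated[OF \<psi>(1) Hdot_scale[OF u, of "real (Suc n)"] _ s])
    show "\<phi> n \<in> borel_measurable lebesgue" unfolding \<phi>_def g_def by measurable
    fix x y
    have "\<bar>\<phi> n x\<bar> \<le> \<bar>\<psi> x\<bar>"
      using g[of n x] \<psi>(2)[of x] by (simp add: \<phi>_def abs_mult mult_left_le)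
    then show "\<bar>\<phi> n x\<bar> \<le> \<bar>\<psi> x\<bar> + \<bar>real (Suc n) * u x\<bar>" by linarith
    have "\<phi> n x - \<phi> n y = (\<psi> x - \<psi> y) * g n x + \<psi> y * (g n x - g n y)"
      by (simp add: \<phi>_def algebra_simps)
    also have "\<bar>\<dots>\<bar> \<le> \<bar>\<psi> x - \<psi> y\<bar> * g n x + \<psi> y * \<bar>g n x - g n y\<bar>"
      using g[of n x] \<psi>(2)[of y] by (intro order_trans[OF abs_triangle_ineq]) (simp add: abs_mult)
    also have "\<dots> \<le> \<bar>\<psi> x - \<psi> y\<bar> * 1 + 1 * \<bar>real (Suc n) * u x - real (Suc n) * u y\<bar>"
      using g[of n x] \<psi>(2,3)[of y] by (intro add_mono mult_mono) (auto simp: g_def)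
    finally show "\<bar>\<phi> n x - \<phi> n y\<bar> \<le> \<bar>\<psi> x - \<psi> y\<bar> + \<bar>real (Suc n) * u x - real (Suc n) * u y\<bar>" by simp
  qed
  define B where "B z = \<bar>gagliardo_integrand s u \<psi> z\<bar>" for z
  have B: "integrable lebesgue2 B" unfolding B_def using gagliardo_integrable[OF u \<psi>(1)] by simp
  define E where "E = gagliardo_integrand s u \<zeta>"
  define h where "h n z = B z - gagliardo_integrand s u (\<phi> n) z" for n z
  have [measurable]: "\<zeta> \<in> borel_measurable lebesgue" unfolding \<zeta>_def by measurable
  have [measurable]: "E \<in> borel_measurable lebesgue2" unfolding E_def by measurable
  have [measurable]: "B \<in> borel_measurable lebesgue2" using B by auto
  have h_int: "integrable lebesgue2 (h n)" for n
    unfolding h_def using B gagliardo_integrable[OF u \<phi>H] by simp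
  have h0: "0 \<le> h n z" for n z
  proof (cases z)
    case (Pair x y)
    \<comment> \<open>The symmetric splitting of the increment of a product.\<close>
    have "(u x - u y) * (\<phi> n x - \<phi> n y) =
        (\<psi> x + \<psi> y) / 2 * ((u x - u y) * (g n x - g n y)) + (u x - u y) * (\<psi> x - \<psi> y) * ((g n x + g n y) / 2)"
      by (simp add: \<phi>_def field_simps)
    also have "\<dots> \<le> 0 + \<bar>(u x - u y) * (\<psi> x - \<psi> y)\<bar> * 1"
    proof (rule add_mono)
      show "(\<psi> x + \<psi> y) / 2 * ((u x - u y) * (g n x - g n y)) \<le> 0"
        using \<psi>(2)[of x] \<psi>(2)[of y] by (intro mult_nonneg_nonpos g_anti) simp
      show "(u x - u y) * (\<psi> x - \<psi> y) * ((g n x + g n y) / 2) \<le> \<bar>(u x - u y) * (\<psi> x - \<psi> y)\<bar> * 1"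
        using g[of n x] g[of n y] by (intro mult_mono abs_ge_self abs_ge_zero) simp_all
    qed
    finally have "(u x - u y) * (\<phi> n x - \<phi> n y) \<le> \<bar>(u x - u y) * (\<psi> x - \<psi> y)\<bar>" by simp
    then show ?thesis
      by (simp add: h_def B_def gagliardo_integrand_def Pair abs_divide divide_right_mono)
  qed
  have E0: "E z \<le> 0" for z
  proof (cases z)
    case (Pair x y)
    have "(u x - u y) * (\<zeta> x - \<zeta> y) \<le> 0"
      using u0[of x] u0[of y] \<psi>(2)[of x] \<psi>(2)[of y]
      by (auto simp: \<zeta>_def mult_nonneg_nonpos mult_nonpos_nonneg)
    then show ?thesis by (simp add: E_def gagliardo_integrand_def Pair divide_nonpos_nonneg)
  qed
  have BE: "0 \<le> B z - E z" for z using E0[of z] abs_ge_zero unfolding B_def by (simp add: order_trans)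
  have lim: "AE z in lebesgue2. (\<lambda>n. h n z) \<longlonglongrightarrow> B z - E z"
  proof (intro AE_I2)
    fix z
    have "(\<lambda>n. \<phi> n x) \<longlonglongrightarrow> \<zeta> x" for x
      unfolding \<phi>_def \<zeta>_def g_def by (intro tendsto_intros truncated_zero_set_tendsto u0)
    then show "(\<lambda>n. h n z) \<longlonglongrightarrow> B z - E z"
      unfolding h_def E_def gagliardo_integrand_def
      by (auto simp: case_prod_unfold divide_inverse intro!: tendsto_intros)
  qed
  have "integral\<^sup>L lebesgue2 (h n) \<le> integral\<^sup>L lebesgue2 B" for n
  proof -
    have "0 \<le> gagliardo_form s u (\<phi> n)"
      using g \<psi>(2) by (intro super \<phi>H) (simp add: \<phi>_def)
    then show ?thesis
      unfolding h_def gagliardo_form_def using B gagliardo_integrable[OF u \<phi>H] by simp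
  qed
  then have lim_int: "integrable lebesgue2 (\<lambda>z. B z - E z)"
      "(LINT z|lebesgue2. B z - E z) \<le> integral\<^sup>L lebesgue2 B"
    using Fatou_integrable[OF _ h_int h0 _ lim, of "integral\<^sup>L lebesgue2 B"] BE by simp_all
  then have E_int: "integrable lebesgue2 E"
    using Bochner_Integration.integrable_diff[OF B lim_int(1)] by simp
  have "(LINT z|lebesgue2. - E z) \<le> 0" using lim_int(2) B E_int by simp
  moreover have "0 \<le> (LINT z|lebesgue2. - E z)"
    using E0 by (intro Bochner_Integration.integral_nonneg) simp
  ultimately have "(LINT z|lebesgue2. - E z) = 0" by simp
  then have "AE z in lebesgue2. - E z = 0"
    using E_int E0 by (subst (asm) integral_nonneg_eq_0_iff_AE) auto
  then have "AE x in lebesgue. AE y in lebesgue. E (x, y) = 0"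
    by (intro lebesgue2.AE_pair) (simp add: eventually_mono)
  then show ?thesis
  proof (rule eventually_mono)
    fix x assume ae: "AE y in lebesgue. E (x, y) = 0"
    show "u x = 0 \<longrightarrow> \<psi> x = 0"
    proof (intro impI, rule ccontr)
      assume x: "u x = 0" "\<psi> x \<noteq> 0"
      have "AE y in lebesgue. u y = 0"
        using ae
      proof eventually_elim
        case (elim y)
        show ?case
        proof (rule ccontr)
          assume y: "u y \<noteq> 0"
          then have "x \<noteq> y" using x by auto
          then show False using elim x y by (simp add: E_def gagliardo_integrand_def \<zeta>_def)
        qed
      qed
      then show False using nz by simp
    qed
  qed
qed

text \<open>
  Almost every point \<open>x\<close> of the zero set satisfies \<open>u (h + x) = 0\<close> for almost every \<open>h\<close>, by Fubini's
  theorem; one such point would force \<open>u = 0\<close> almost everywhere.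
\<close>

lemma zero_set_null_of_translates:
  fixes u :: "'a::euclidean_space \<Rightarrow> real"
  assumes [measurable]: "u \<in> borel_measurable lebesgue" and nz: "\<not> (AE x in lebesgue. u x = 0)"
    and trans: "\<And>h. AE x in lebesgue. u x = 0 \<longrightarrow> u (h + x) = 0"
  shows "AE x in lebesgue. u x \<noteq> 0"
proof -
  \<comment> \<open>A Borel representative: for a Lebesgue measurable \<open>u\<close> the map \<open>(h, x) \<mapsto> u (h + x)\<close> need not be measurable for the product.\<close>
  obtain v where v [measurable]: "v \<in> borel_measurable lborel" and uv: "AE x in lborel. u x = v x"
    using completion_ex_borel_measurable_real[of u lborel] by auto
  then have uv': "AE x in lebesgue. u x = v x" by (simp add: AE_completion)
  have plus: "(AE x in lborel. P (h + x)) \<longleftrightarrow> (AE x in lborel. P x)"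
    if [measurable]: "Measurable.pred borel P" for P and h :: 'a
    using AE_distr_iff[of "(+) h" lborel borel P] unfolding lborel_distr_plus by simp
  have "AE x in lborel. v x = 0 \<longrightarrow> v (h + x) = 0" for h
  proof -
    have "AE x in distr lebesgue lebesgue ((+) h). u x = v x"
      unfolding lebesgue_distr_translation by (rule uv')
    then have "AE x in lebesgue. u (h + x) = v (h + x)"
      by (rule AE_distrD[OF lebesgue_distr_translation(1)])
    with trans[of h] uv' have "AE x in lebesgue. v x = 0 \<longrightarrow> v (h + x) = 0" by eventually_elim simp
    then show ?thesis by (simp add: AE_completion_iff)
  qed
  then have "AE h in lborel. AE x in lborel. v x = 0 \<longrightarrow> v (h + x) = 0" by simp
  then have "AE x in lborel. AE h in lborel. v x = 0 \<longrightarrow> v (h + x) = 0"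
  proof (rule iffD1[OF lborel_pair.AE_commute, rotated])
    have [measurable]: "(\<lambda>z. v (fst z + snd z)) \<in> borel_measurable (lborel \<Otimes>\<^sub>M lborel)"
      by measurable
    show "{z \<in> space (lborel \<Otimes>\<^sub>M lborel). v (snd z) = 0 \<longrightarrow> v (fst z + snd z) = 0} \<in> sets (lborel \<Otimes>\<^sub>M lborel)"
      by measurable
  qed
  then have "AE x in lborel. v x \<noteq> 0"
  proof (rule eventually_mono)
    fix x assume "AE h in lborel. v x = 0 \<longrightarrow> v (h + x) = 0"
    then have "v x = 0 \<longrightarrow> (AE h in lborel. v (x + h) = 0)" by (simp add: add.commute)
    then have "v x = 0 \<longrightarrow> (AE y in lborel. v y = 0)"
      using plus[of "\<lambda>y. v y = 0" x] by simp
    moreover have "\<not> (AE y in lborel. v y = 0)"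
    proof
      assume "AE y in lborel. v y = 0"
      with uv have "AE y in lborel. u y = 0" by eventually_elim simp
      then show False using nz AE_completion by blast
    qed
    ultimately show "v x \<noteq> 0" by blast
  qed
  with uv have "AE x in lborel. u x \<noteq> 0" by eventually_elim simp
  then show ?thesis by (rule AE_completion)
qed

lemma nonlocal_strong_maximum_principle:
  fixes u :: "'a::euclidean_space \<Rightarrow> real"
  assumes s: "0 < s" "2 * s < real DIM('a)"
    and u: "u \<in> Hdot s" and u0: "\<And>x. 0 \<le> u x"
    and super: "\<And>\<phi>. \<phi> \<in> Hdot s \<Longrightarrow> (\<And>x. 0 \<le> \<phi> x) \<Longrightarrow> 0 \<le> gagliardo_form s u \<phi>"
    and nz: "\<not> (AE x in lebesgue. u x = 0)"
  shows "AE x in lebesgue. 0 < u x"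
proof -
  have "AE x in lebesgue. u x = 0 \<longrightarrow> u (h + x) = 0" for h
  proof -
    note uh = Hdot_translation[OF u, of h]
    note [measurable] = HdotD(1)[OF uh]
    \<comment> \<open>The truncated translate is the cutoff function \<open>\<psi>\<close>.\<close>
    have "(\<lambda>x. min 1 (u (h + x))) \<in> Hdot s"
      by (rule Hdot_dominated[OF uh uh _ s]) (use u0 in \<open>auto simp: min_def\<close>)
    then have "AE x in lebesgue. u x = 0 \<longrightarrow> min 1 (u (h + x)) = 0"
      using u0 by (intro nonlocal_supersolution_zero_set[OF s u u0 super nz]) auto
    then show ?thesis by eventually_elim (auto simp: min_def split: if_splits)
  qed
  from zero_set_null_of_translates[OF HdotD(1)[OF u] nz this]
  show ?thesis by (rule eventually_mono) (use u0 in \<open>simp add: less_le\<close>)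
qed

section \<open>Existence of a positive solution\<close>

context critical_problem
begin

text \<open>
  Tested with the negative part \<open>m\<close> of \<open>u\<close>, the critical term vanishes and \<open>f\<close> contributes
  a nonnegative number, while the form is at most \<open>- [m]\<^sup>2\<close>. Hence \<open>[m] = 0\<close>, and \<open>u\<close> and its positive part \<open>u + m\<close>
  are indistinguishable for the form and for \<open>f\<close>. Passing to the positive part makes nonnegativity hold at
  every point rather than almost everywhere.
\<close>

lemma solution_nonneg_representative:
  assumes f: "f \<in> Hdot_dual s" "nonneg_functional s f" and u: "u \<in> Hdot s"
    and solves: "\<And>\<phi>. \<phi> \<in> Hdot s \<Longrightarrow> gagliardo_form s u \<phi> = nonlin_deriv u \<phi> + f \<phi>"
  defines "v \<equiv> \<lambda>x. max 0 (u x)"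
  shows "v \<in> Hdot s" "trunc_energy f v = trunc_energy f u"
    "\<And>\<phi>. \<phi> \<in> Hdot s \<Longrightarrow> gagliardo_form s v \<phi> = nonlin_deriv v \<phi> + f \<phi>"
proof -
  note [measurable] = HdotD'(1)[OF u]
  show v: "v \<in> Hdot s"
  proof (rule Hdot_dominated[OF u u _ s])
    show "v \<in> borel_measurable lebesgue" unfolding v_def by measurable
    show "\<bar>v x\<bar> \<le> \<bar>u x\<bar> + \<bar>u x\<bar>" for x by (simp add: v_def)
    show "\<bar>v x - v y\<bar> \<le> \<bar>u x - u y\<bar> + \<bar>u x - u y\<bar>" for x y
      unfolding v_def by (smt (verit))
  qed
  define m where "m x = max 0 (- u x)" for x
  have m: "m \<in> Hdot s"
  proof (rule Hdot_dominated[OF u u _ s])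
    show "m \<in> borel_measurable lebesgue" unfolding m_def by measurable
    show "\<bar>m x\<bar> \<le> \<bar>u x\<bar> + \<bar>u x\<bar>" for x by (simp add: m_def)
    show "\<bar>m x - m y\<bar> \<le> \<bar>u x - u y\<bar> + \<bar>u x - u y\<bar>" for x y
      unfolding m_def by (smt (verit))
  qed
  have G0: "nonlin_deriv u m = 0"
  proof -
    have "a x * max 0 (u x) powr (p - 1) * m x = 0" for x by (auto simp: m_def max_def)
    then show ?thesis unfolding nonlin_deriv_def by (simp only: Bochner_Integration.integral_zero)
  qed
  have f0: "0 \<le> f m" using f(2) m by (auto simp: nonneg_functional_def m_def)
  have "gagliardo_form s u m \<le> (LINT z|lebesgue2. - gagliardo_integrand s m m z)"
    unfolding gagliardo_form_def
  proof (rule integral_mono[OF gagliardo_integrable[OF u m]])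
    show "integrable lebesgue2 (\<lambda>z. - gagliardo_integrand s m m z)"
      using gagliardo_integrable[OF m m] by simp
    fix z :: "'a \<times> 'a"
    obtain x y where z: "z = (x, y)" by (cases z)
    have um: "u t = v t - m t" "v t * m t = 0" "0 \<le> v t" "0 \<le> m t" for t
      by (auto simp: v_def m_def max_def)
    have "(u x - u y) * (m x - m y) + (m x - m y) * (m x - m y) =
        v x * m x + v y * m y - v x * m y - v y * m x"
      unfolding um(1) by (simp add: algebra_simps)
    also have "\<dots> \<le> 0"
      using mult_nonneg_nonneg[OF um(3,4), of x y] mult_nonneg_nonneg[OF um(3,4), of y x] by (simp add: um(2))
    finally have "(u x - u y) * (m x - m y) \<le> - ((m x - m y) * (m x - m y))" by simp
    then show "gagliardo_integrand s u m z \<le> - gagliardo_integrand s m m z"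
      unfolding z gagliardo_integrand_def split minus_divide_left by (rule divide_right_mono) simp
  qed
  then have "gagliardo_form s m m \<le> 0"
    using solves[OF m] G0 f0 by (simp add: gagliardo_form_def)
  then have n0: "Hdot_norm s m = 0" using form_nonneg[of s m] by (simp add: Hdot_norm_def)
  have vm: "v = (\<lambda>x. u x + m x)" by (auto simp: v_def m_def max_def)
  have fm: "gagliardo_form s v \<phi> = gagliardo_form s u \<phi>" if "\<phi> \<in> Hdot s" for \<phi>
    unfolding vm using form_add_left[OF u m that] form_cauchy_schwarz[OF m that s] n0 by simp
  have Fv: "nonlin v = nonlin u" and Gv: "nonlin_deriv v \<phi> = nonlin_deriv u \<phi>" for \<phi> by (simp_all add: nonlin_def nonlin_deriv_def v_def)
  have "gagliardo_form s v v = gagliardo_form s u u"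
    using fm[OF v] fm[OF u] form_commute[of s u v] by simp
  moreover have "f v = f u"
  proof -
    obtain c where "\<bar>f m\<bar> \<le> c * Hdot_norm s m" using Hdot_dual_bounded[OF f(1)] m by metis
    then show ?thesis unfolding vm using Hdot_dual_add[OF f(1) u m] n0 by simp
  qed
  ultimately show "trunc_energy f v = trunc_energy f u" by (simp add: trunc_energy_def Hdot_norm_sq Fv)
  show "gagliardo_form s v \<phi> = nonlin_deriv v \<phi> + f \<phi>" if "\<phi> \<in> Hdot s" for \<phi>
    using fm[OF that] solves[OF that] by (simp add: Gv)
qed

lemma trunc_energy_null:
  assumes f: "f \<in> Hdot_dual s" and u: "u \<in> Hdot s" and null: "AE x in lebesgue. u x = 0"
  shows "trunc_energy f u = 0"
proof -
  have "AE z in lebesgue2. gagliardo_integrand s u u z = 0"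
    using AE_lebesgue2[OF null] by eventually_elim (auto simp: gagliardo_integrand_def)
  then have "gagliardo_form s u u = 0"
    unfolding gagliardo_form_def by (rule integral_eq_zero_AE)
  then have n: "Hdot_norm s u = 0" by (simp add: Hdot_norm_def)
  obtain c where "\<bar>f u\<bar> \<le> c * Hdot_norm s u" using Hdot_dual_bounded[OF f] u by metis
  moreover have "nonlin u = 0"
    unfolding nonlin_def using null by (intro integral_eq_zero_AE) (auto elim!: eventually_mono)
  ultimately show ?thesis using n by (simp add: trunc_energy_def)
qed

theorem positive_solution_exists:
  assumes f: "f \<in> Hdot_dual s" "nonneg_functional s f" and nz: "\<phi>0 \<in> Hdot s" "f \<phi>0 \<noteq> 0"
    and R: "0 < R" "remainder_const * R powr (p - 2) \<le> 1 / 4" and d: "Hdot_dual_norm s f \<le> R / 4"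
  shows "\<exists>u. positive_weak_solution s a f u \<and> energy s a f u < 0"
proof -
  obtain w where w: "w \<in> Hdot s" "trunc_energy f w < 0"
    "\<And>\<phi>. \<phi> \<in> Hdot s \<Longrightarrow> gagliardo_form s w \<phi> = nonlin_deriv w \<phi> + f \<phi>"
    using local_minimizer_solves[OF f(1) nz R d] by blast
  define u where "u x = max 0 (w x)" for x
  have u: "u \<in> Hdot s" "trunc_energy f u = trunc_energy f w" "\<And>\<phi>. \<phi> \<in> Hdot s \<Longrightarrow> gagliardo_form s u \<phi> = nonlin_deriv u \<phi> + f \<phi>"
    using solution_nonneg_representative[OF f w(1)] w(3) unfolding u_def[abs_def] by auto
  have u0: "0 \<le> u x" for x by (simp add: u_def)
  have "AE x in lebesgue. 0 < u x"
  proof (rule nonlocal_strong_maximum_principle[OF s u(1) u0])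
    show "\<not> (AE x in lebesgue. u x = 0)" using trunc_energy_null[OF f(1) u(1)] u(2) w(2) by auto
    fix \<phi> :: "'a \<Rightarrow> real" assume \<phi>: "\<phi> \<in> Hdot s" "\<And>x. 0 \<le> \<phi> x"
    have "0 \<le> nonlin_deriv u \<phi>" unfolding nonlin_deriv_def
      using a_bounds \<phi>(2) by (intro integral_nonneg_AE) (auto elim!: eventually_mono)
    moreover have "0 \<le> f \<phi>" using f(2) \<phi> by (auto simp: nonneg_functional_def)
    ultimately show "0 \<le> gagliardo_form s u \<phi>" using u(3)[OF \<phi>(1)] by simp
  qed
  moreover have "nonlin_deriv u \<phi> = (LINT x|lebesgue. a x * u x powr (p - 1) * \<phi> x)" for \<phi>
    using u0 by (simp add: nonlin_deriv_def max_absorb2)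
  moreover have "energy s a f u = trunc_energy f u"
    using u0 unfolding energy_def trunc_energy_def nonlin_def p_def[symmetric] by (simp add: max_absorb2)
  ultimately show ?thesis
    using u w(2) unfolding positive_weak_solution_def p_def[symmetric] by (intro exI[of _ u]) auto
qed

end

theorem theorem1p1:
  fixes s :: real and a :: "real ^ 'n \<Rightarrow> real"
  assumes "0 < s" and "s < 1" and "2 * s < real CARD('n)"
    and "a \<in> Linfty" and "AE x in lebesgue. 0 < a x"
  shows "\<exists>d>0. \<forall>f \<in> Hdot_dual s.
           nonneg_functional s f \<and> (\<exists>\<phi>\<in>Hdot s. f \<phi> \<noteq> 0) \<and> Hdot_dual_norm s f \<le> d \<longrightarrow>
           (\<exists>u. positive_weak_solution s a f u \<and> energy s a f u < 0)"
proof -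
  have s: "0 < s" "2 * s < real DIM(real ^ 'n)" using assms by simp_all
  obtain C where C: "AE x in lebesgue. \<bar>a x\<bar> \<le> C" using assms(4) by (auto simp: Linfty_def)
  obtain S where S: "0 < S" "\<And>u :: real ^ 'n \<Rightarrow> real. u \<in> Hdot s \<Longrightarrow>
      (LINT x|lebesgue. \<bar>u x\<bar> powr crit_exp DIM(real ^ 'n) s) \<le> S * Hdot_norm s u powr crit_exp DIM(real ^ 'n) s"
    using fractional_Sobolev_integral[OF s] by blast
  interpret critical_problem s a "max 1 C" S "crit_exp DIM(real ^ 'n) s"
  proof
    show "a \<in> borel_measurable lebesgue" using assms(4) by (simp add: Linfty_def)
    show "AE x in lebesgue. 0 \<le> a x \<and> a x \<le> max 1 C"
      using C assms(5) by eventually_elim auto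
  qed (use s S in \<open>auto\<close>)
  \<comment> \<open>The radius for which the remainder constant on the ball is exactly \<open>1/4\<close>.\<close>
  define R where "R = (1 / (4 * remainder_const)) powr (1 / (crit_exp DIM(real ^ 'n) s - 2))"
  have R: "0 < R" "remainder_const * R powr (crit_exp DIM(real ^ 'n) s - 2) \<le> 1 / 4"
    using remainder_const_pos p2 by (simp_all add: R_def powr_powr)
  show ?thesis
    using positive_solution_exists[OF _ _ _ _ R] R(1) by (intro exI[of _ "R / 4"]) auto
qed

end
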